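(* Let $\phi$, $F$ and $j$ satisfy the standing assumptions stated in the context. If $\nabla_uF$ is bounded on $[0,T]\times\mathbb{R}^N$ and $$\lim_{|x|\to\infty}\int_0^TF(t,x)\,dt=-\infty,$$ then the boundary value problem $$-[\phi(u')]'=\nabla_uF(t,u)\ \text{ in }[0,T],\qquad \big(\phi(u')(0),-\phi(u')(T)\big)\in\partial j(u(0),u(T))$$ has at least one solution.
   Context: $N\ge 1$ is an integer, $T>0$, $0<a<\infty$; $|\cdot|$ is the Euclidean norm on $\mathbb{R}^N$; $B_a$ is the open ball of radius $a$ centered at $0$. Standing assumptions. (1) $\phi$ is a homeomorphism from $B_a$ onto $\mathbb{R}^N$ with $\phi(0)=0$ and $\phi=\nabla\Phi$ on $B_a$, where $\Phi:\overline{B}_a\to(-\infty,0]$ is of class $C^1$ on $B_a$, and continuous and strictly convex on $\overline{B}_a$. (2) $F=F(t,u):[0,T]\times\mathbb{R}^N\to\mathbb{R}$ is continuous, $\nabla_uF$ exists and is continuous on $[0,T]\times\mathbb{R}^N$, and $F(\cdot,0)=0$. (3) $j:\mathbb{R}^N\times\mathbb{R}^N\to(-\infty,+\infty]$ is proper, convex, lower semicontinuous, $j(0)=0$ and $0\in\partial j(0)$, where $\partial j$ is the subdifferential of convex analysis. A solution of the boundary value problem is a function $u\in C^1([0,T];\mathbb{R}^N)$ with $|u'(t)|<a$ for all $t\in[0,T]$, $\phi(u')\in C^1([0,T];\mathbb{R}^N)$, $(u(0),u(T))\in D(\partial j)=\{z:\partial j(z)\ne\emptyset\}$, satisfying the system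 and the boundary condition; $\phi(u')(t)=\phi(u'(t))$. *)

theory Defs
  imports "HOL-Analysis.Analysis"
begin

definition strictly_convex_on :: "'a::real_vector set \<Rightarrow> ('a \<Rightarrow> real) \<Rightarrow> bool" where
  "strictly_convex_on S f \<longleftrightarrow> convex S \<and>
     (\<forall>x\<in>S. \<forall>y\<in>S. \<forall>s. x \<noteq> y \<longrightarrow> 0 < s \<longrightarrow> s < 1 \<longrightarrow>
        f ((1 - s) *\<^sub>R x + s *\<^sub>R y) < (1 - s) * f x + s * f y)"

definition proper_fun :: "('a \<Rightarrow> ereal) \<Rightarrow> bool" where
  "proper_fun f \<longleftrightarrow> (\<forall>x. f x \<noteq> - \<infinity>) \<and> (\<exists>x. f x \<noteq> \<infinity>)"

(* Only 0 < s < 1 is used, so no product 0 * \<infinity> occurs; for f avoiding -\<infinity>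
   no sum \<infinity> - \<infinity> occurs either. *)
definition convex_fun :: "('a::real_vector \<Rightarrow> ereal) \<Rightarrow> bool" where
  "convex_fun f \<longleftrightarrow> (\<forall>x y s. 0 < s \<longrightarrow> s < 1 \<longrightarrow>
     f ((1 - s) *\<^sub>R x + s *\<^sub>R y) \<le> ereal (1 - s) * f x + ereal s * f y)"

definition lsc_fun :: "('a::topological_space \<Rightarrow> ereal) \<Rightarrow> bool" where
  "lsc_fun f \<longleftrightarrow> (\<forall>x c. c < f x \<longrightarrow> (\<forall>\<^sub>F y in nhds x. c < f y))"

(* The defining inequality f y - f z \<ge> p \<bullet> (y - z), with f z moved to the other side
   so that it is meaningful for infinite values.  For a proper f the subdifferential
   is therefore empty wherever f is infinite. *)
definition subdifferential :: "('a::real_inner \<Rightarrow> ereal) \<Rightarrow> 'a \<Rightarrow> 'a set" where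
  "subdifferential f z = {p. \<forall>y. f z + ereal (p \<bullet> (y - z)) \<le> f y}"

definition subdiff_domain :: "('a::real_inner \<Rightarrow> ereal) \<Rightarrow> 'a set" where
  "subdiff_domain f = {z. subdifferential f z \<noteq> {}}"

(* u is of class C^1 on the closed interval S, with derivative v; derivatives at the
   endpoints are one-sided, unlike in C1_differentiable_on. *)
definition C1_with_deriv_on ::
    "(real \<Rightarrow> 'a::real_normed_vector) \<Rightarrow> (real \<Rightarrow> 'a) \<Rightarrow> real set \<Rightarrow> bool" where
  "C1_with_deriv_on u v S \<longleftrightarrow>
     (\<forall>t\<in>S. (u has_vector_derivative v t) (at t within S)) \<and> continuous_on S v"

(* g t x is the gradient in x of F; v is u' and w is [\<phi>(u')]'. *)
definition is_solution ::
    "real \<Rightarrow> real \<Rightarrow> ('a::real_inner \<Rightarrow> 'a) \<Rightarrow> (real \<Rightarrow> 'a \<Rightarrow> 'a) \<Rightarrow> ('a \<times> 'a \<Rightarrow> ereal) \<Rightarrow>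
     (real \<Rightarrow> 'a) \<Rightarrow> bool" where
  "is_solution T a \<phi> g j u \<longleftrightarrow>
     (\<exists>v w. C1_with_deriv_on u v {0..T} \<and>
        (\<forall>t\<in>{0..T}. norm (v t) < a) \<and>
        C1_with_deriv_on (\<lambda>t. \<phi> (v t)) w {0..T} \<and>
        (u 0, u T) \<in> subdiff_domain j \<and>
        (\<forall>t\<in>{0..T}. - w t = g t (u t)) \<and>
        (\<phi> (v 0), - \<phi> (v T)) \<in> subdifferential j (u 0, u T))"

end

theory Submission
  imports Defs "HOL-Complex_Analysis.Great_Picard"
begin

text \<open>
  Time is cut into $n + 1$ cells of equal length, and the action functional is minimised over
  discrete curves. Since the gradient of \<open>F\<close> is bounded and speeds are at most \<open>a\<close>, a curve stays close to its
  initial point, so anticoercivity of the integral of \<open>F\<close> confines minimising sequences to a ball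
  that does not depend on \<open>n\<close>. Comparing a minimiser \<open>u\<close> with \<open>(1 - s) u\<close> shows that all speeds are
  strictly below \<open>a\<close>, because $|\phi|$ blows up at the boundary of the ball; varying \<open>u\<close> then gives
  the discrete Euler--Lagrange equation and the boundary inclusion, and the direction \<open>- u\<close> bounds
  the momenta $\phi(u')$ uniformly in \<open>n\<close>. Hence positions and momenta have bounded increments, a
  subsequence converges uniformly, and the limit is differentiable with the right derivative
  because difference quotients are averages of the discrete velocities.
\<close>

subsection \<open>Limits of discrete curves\<close>

definition ramp :: "real \<Rightarrow> real" where
  "ramp x = max 0 (min 1 x)"

text \<open>The piecewise linear interpolant of the values \<open>x k\<close> at the times
  \<open>k * h\<close>. The \<open>k\<close>-th ramp climbs from 0 to 1 exactly while
  \<open>t\<close> crosses cell \<open>k\<close>, so no search for the cell containing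
  \<open>t\<close> is needed.\<close>

definition polyline :: "real \<Rightarrow> nat \<Rightarrow> (nat \<Rightarrow> 'a::real_vector) \<Rightarrow> real \<Rightarrow> 'a" where
  "polyline h N x t = x 0 + (\<Sum>k<N. ramp (t / h - real k) *\<^sub>R (x (Suc k) - x k))"

lemma ramp_mono: "x \<le> y \<Longrightarrow> ramp x \<le> ramp y"
  by (auto simp: ramp_def)

lemma sum_ramp: "(\<Sum>k<N. ramp (x - real k)) = max 0 (min (real N) x)"
  by (induction N) (auto simp: ramp_def)

lemma polyline_node:
  assumes "k \<le> N" "h > 0"
  shows "polyline h N x (real k * h) = x k"
proof -
  have "(\<Sum>i<N. ramp (real k * h / h - real i) *\<^sub>R (x (Suc i) - x i)) = (\<Sum>i<k. x (Suc i) - x i)"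
    using assms by (intro sum.mono_neutral_cong_right) (auto simp: ramp_def)
  then show ?thesis
    by (simp add: polyline_def sum_lessThan_telescope)
qed

text \<open>The increment over \<open>[s, t]\<close> is a combination of the slopes
  \<open>y k\<close> with nonnegative weights of total \<open>t - s\<close>. With
  \<open>c = 0\<close> this is a Lipschitz bound; with \<open>c\<close> a candidate derivative it is
  the differentiability estimate.\<close>

lemma polyline_increment_bound:
  fixes x y :: "nat \<Rightarrow> 'a::real_normed_vector"
  assumes h: "h > 0" and st: "0 \<le> s" "s \<le> t" "t \<le> real N * h"
    and step: "\<And>k. k < N \<Longrightarrow> x (Suc k) - x k = h *\<^sub>R y k"
    and near: "\<And>k. k < N \<Longrightarrow> s < real (Suc k) * h \<Longrightarrow> real k * h < t \<Longrightarrow> norm (y k - c) \<le> e"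
  shows "norm (polyline h N x t - polyline h N x s - (t - s) *\<^sub>R c) \<le> e * (t - s)"
proof -
  \<comment> \<open>\<open>d k\<close> is the length of the part of cell \<open>k\<close> that lies
    in \<open>[s, t]\<close>.\<close>
  define d where "d k = (ramp (t / h - real k) - ramp (s / h - real k)) * h" for k
  have le: "s / h \<le> t / h" using st h by (simp add: divide_right_mono)
  have d0: "d k \<ge> 0" for k
    using ramp_mono[of "s / h - real k" "t / h - real k"] le h by (simp add: d_def)
  have "s / h \<le> real N" "t / h \<le> real N" "0 \<le> s / h" "0 \<le> t / h"
    using st h by (auto simp: field_simps)
  then have "(\<Sum>k<N. d k) = (t / h - s / h) * h"
    by (simp add: d_def sum_distrib_right[symmetric] sum_subtractf sum_ramp)
  then have dsum: "(\<Sum>k<N. d k) = t - s"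
    using h by (simp add: left_diff_distrib)
  have "polyline h N x t - polyline h N x s = (\<Sum>k<N. d k *\<^sub>R y k)"
    by (simp add: polyline_def sum_subtractf[symmetric] step d_def algebra_simps)
  also have "\<dots> - (t - s) *\<^sub>R c = (\<Sum>k<N. d k *\<^sub>R (y k - c))"
    by (simp add: dsum[symmetric] scaleR_sum_left sum_subtractf scaleR_diff_right)
  also have "norm \<dots> \<le> (\<Sum>k<N. d k * e)"
  proof (rule sum_norm_le)
    fix k assume "k \<in> {..<N}"
    then have k: "k < N" by simp
    show "norm (d k *\<^sub>R (y k - c)) \<le> d k * e"
    \<comment> \<open>Cells of weight zero contribute nothing; a nonzero weight forces the two
      inequalities that \<open>near\<close> asks for.\<close>
    proof (cases "d k = 0")
      case False
      then have ne: "ramp (t / h - real k) \<noteq> ramp (s / h - real k)"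
        by (auto simp: d_def)
      have "s < real (Suc k) * h"
      proof (rule ccontr)
        assume "\<not> ?thesis"
        then have "s / h \<ge> real (Suc k)" using h by (simp add: field_simps)
        then show False using ne le by (simp add: ramp_def)
      qed
      moreover have "real k * h < t"
      proof (rule ccontr)
        assume "\<not> ?thesis"
        then have "t / h \<le> real k" using h by (simp add: field_simps)
        then show False using ne le by (simp add: ramp_def)
      qed
      ultimately show ?thesis using near[OF k] d0[of k] by (simp add: mult_left_mono)
    qed simp
  qed
  also have "\<dots> = e * (t - s)"
    by (simp add: dsum[symmetric] sum_distrib_left mult.commute)
  finally show ?thesis .
qed

text \<open>Arzela-Ascoli applies because the interpolants share the Lipschitz constant
  \<open>L\<close>. The last clause asks only that \<open>Y\<close> be close to \<open>Z\<close> in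
  cells near \<open>t\<close>: difference quotients of the interpolants are averages of such
  \<open>Y\<close>, and the estimate survives the uniform limit.\<close>

lemma discrete_curves_subconverge:
  fixes X Y :: "nat \<Rightarrow> nat \<Rightarrow> 'e::euclidean_space" and T L R :: real
  assumes T: "T > 0"
    and step: "\<And>n k. k < Suc n \<Longrightarrow> X n (Suc k) - X n k = (T / real (Suc n)) *\<^sub>R Y n k"
    and L: "\<And>n k. k < Suc n \<Longrightarrow> norm (Y n k) \<le> L"
    and R: "\<And>n. norm (X n 0) \<le> R"
  obtains f r where "strict_mono (r :: nat \<Rightarrow> nat)" "continuous_on {0..T} f"
    "\<And>e. e > 0 \<Longrightarrow> \<exists>M. \<forall>n\<ge>M. \<forall>k\<le>Suc (r n).
       norm (X (r n) k - f (real k * (T / real (Suc (r n))))) < e"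
    "\<And>t Z. \<lbrakk>t \<in> {0..T}; \<And>e. e > 0 \<Longrightarrow> \<exists>d>0. \<exists>M. \<forall>n\<ge>M. \<forall>k<Suc (r n).
       \<bar>real k * (T / real (Suc (r n))) - t\<bar> < d \<longrightarrow> norm (Y (r n) k - Z) \<le> e\<rbrakk>
       \<Longrightarrow> (f has_vector_derivative Z) (at t within {0..T})"
proof -
  define h where "h n = T / real (Suc n)" for n
  have h0: "h n > 0" for n using T by (simp add: h_def)
  have hT: "real (Suc n) * h n = T" for n by (simp add: h_def)
  have h_lim: "h \<longlonglongrightarrow> 0"
    unfolding h_def by (intro real_tendsto_divide_at_top[OF tendsto_const]
        filterlim_compose[OF filterlim_real_sequentially filterlim_Suc])
  define P where "P n = polyline (h n) (Suc n) (X n)" for n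
  have L0: "L \<ge> 0" using L[of 0 0] norm_ge_zero order_trans by blast
  have incr: "norm (P n t - P n s) \<le> L * (t - s)" if "0 \<le> s" "s \<le> t" "t \<le> T" for n s t
  proof -
    have "norm (polyline (h n) (Suc n) (X n) t - polyline (h n) (Suc n) (X n) s - (t - s) *\<^sub>R 0)
        \<le> L * (t - s)"
      by (rule polyline_increment_bound[where y = "Y n"])
        (use that hT[of n] h0[of n] step L in \<open>auto simp: h_def simp del: of_nat_Suc\<close>)
    then show ?thesis by (simp add: P_def)
  qed
  have lip: "norm (P n t - P n s) \<le> L * \<bar>t - s\<bar>" if "s \<in> {0..T}" "t \<in> {0..T}" for n s t
    using incr[of s t n] incr[of t s n] that by (cases "s \<le> t") (auto simp: norm_minus_commute)
  have P0: "P n 0 = X n 0" for n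
    using polyline_node[of 0 "Suc n" "h n" "X n"] h0 by (simp add: P_def)
  have bd: "norm (P n t) \<le> R + L * T" if "t \<in> {0..T}" for n t
  proof -
    have "norm (P n t) \<le> norm (P n 0) + norm (P n t - P n 0)"
      using norm_triangle_sub by blast
    also have "\<dots> \<le> R + L * \<bar>t - 0\<bar>"
      using lip[of 0 t n] that R[of n] T by (simp add: P0)
    also have "\<dots> \<le> R + L * T" using that L0 by (simp add: mult_left_mono)
    finally show ?thesis .
  qed
  have equi: "\<exists>d. 0 < d \<and> (\<forall>n y. y \<in> {0..T} \<and> norm (t - y) < d \<longrightarrow> norm (P n t - P n y) < e)"
    if "t \<in> {0..T}" "0 < e" for t e
  \<comment> \<open>The divisor is \<open>L + 1\<close> because \<open>L\<close> may be 0.\<close>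
  proof (intro exI[of _ "e / (L + 1)"] conjI allI impI)
    show "0 < e / (L + 1)" using that L0 by simp
    fix n y assume y: "y \<in> {0..T} \<and> norm (t - y) < e / (L + 1)"
    have "norm (P n t - P n y) \<le> L * \<bar>t - y\<bar>" using lip[of y t n] y that by simp
    also have "\<dots> \<le> (L + 1) * \<bar>t - y\<bar>" by (simp add: mult_right_mono)
    also have "\<dots> < e" using y L0 by (simp add: field_simps)
    finally show "norm (P n t - P n y) < e" .
  qed
  obtain f r where f: "continuous_on {0..T} f" and r: "strict_mono (r :: nat \<Rightarrow> nat)"
    and conv: "\<And>e. 0 < e \<Longrightarrow> \<exists>N. \<forall>n x. n \<ge> N \<and> x \<in> {0..T} \<longrightarrow> norm (P (r n) x - f x) < e"
    using Arzela_Ascoli[of "{0..T}" P "R + L * T", OF compact_Icc bd equi] by blast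
  have hr: "(\<lambda>n. h (r n)) \<longlonglongrightarrow> 0"
    using LIMSEQ_subseq_LIMSEQ[OF h_lim r] by (simp add: o_def)
  show thesis
  proof (rule that[OF r f])
    fix e :: real assume "e > 0"
    then obtain N where N: "\<forall>n x. n \<ge> N \<and> x \<in> {0..T} \<longrightarrow> norm (P (r n) x - f x) < e"
      using conv by blast
    have "norm (X (r n) k - f (real k * (T / real (Suc (r n))))) < e"
      if "n \<ge> N" "k \<le> Suc (r n)" for n k
    proof -
      have "real k * h (r n) \<le> real (Suc (r n)) * h (r n)"
        using that h0[of "r n"] by (intro mult_right_mono) auto
      then have "real k * h (r n) \<in> {0..T}"
        using h0[of "r n"] less_imp_le unfolding hT by simp
      then show ?thesis
        using N that polyline_node[of k "Suc (r n)" "h (r n)" "X (r n)"] h0[of "r n"]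
        by (force simp: P_def h_def)
    qed
    then show "\<exists>M. \<forall>n\<ge>M. \<forall>k\<le>Suc (r n).
       norm (X (r n) k - f (real k * (T / real (Suc (r n))))) < e" by blast
  next
    fix t Z
    assume t: "t \<in> {0..T}" and near: "\<And>e. e > 0 \<Longrightarrow> \<exists>d>0. \<exists>M. \<forall>n\<ge>M. \<forall>k<Suc (r n).
       \<bar>real k * (T / real (Suc (r n))) - t\<bar> < d \<longrightarrow> norm (Y (r n) k - Z) \<le> e"
    have lim: "(\<lambda>n. P (r n) s) \<longlonglongrightarrow> f s" if "s \<in> {0..T}" for s
      unfolding LIMSEQ_iff using conv that by blast
    have "\<exists>d>0. \<forall>s\<in>{0..T}. norm (s - t) < d \<longrightarrow>
        norm (f s - f t - (s - t) *\<^sub>R Z) \<le> e * norm (s - t)" if "e > 0" for e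
    proof -
      obtain d M where d: "d > 0" and M: "\<forall>n\<ge>M. \<forall>k<Suc (r n).
          \<bar>real k * h (r n) - t\<bar> < d \<longrightarrow> norm (Y (r n) k - Z) \<le> e"
        using near[OF \<open>e > 0\<close>] unfolding h_def by blast
      \<comment> \<open>The cases \<open>p = t\<close> and \<open>q = t\<close> will cover the two
        sides of \<open>t\<close>. A cell meeting \<open>[p, q]\<close> may start one mesh width
        before \<open>p\<close>, so half of \<open>d\<close> is reserved for the mesh width.\<close>
      have main: "norm (f q - f p - (q - p) *\<^sub>R Z) \<le> e * (q - p)"
        if pq: "p \<in> {0..T}" "q \<in> {0..T}" "p \<le> q" "t - d / 2 < p" "q < t + d / 2" for p q
      proof (rule tendsto_upperbound[OF _ _ trivial_limit_sequentially])
        show "(\<lambda>n. norm (P (r n) q - P (r n) p - (q - p) *\<^sub>R Z))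
            \<longlonglongrightarrow> norm (f q - f p - (q - p) *\<^sub>R Z)"
          by (intro tendsto_intros lim pq)
        have "eventually (\<lambda>n. h (r n) < d / 2) sequentially"
          using order_tendstoD(2)[OF hr, of "d / 2"] d by simp
        then show "\<forall>\<^sub>F n in sequentially. norm (P (r n) q - P (r n) p - (q - p) *\<^sub>R Z) \<le> e * (q - p)"
          using eventually_ge_at_top[of M]
        proof eventually_elim
          case (elim n)
          show ?case unfolding P_def
          proof (rule polyline_increment_bound[where y = "Y (r n)"])
            fix k assume k: "k < Suc (r n)" and a: "p < real (Suc k) * h (r n)" "real k * h (r n) < q"
            from a(1) have "p < real k * h (r n) + h (r n)" by (simp add: algebra_simps)
            then have "\<bar>real k * h (r n) - t\<bar> < d"
              using a(2) pq elim by linarith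
            then show "norm (Y (r n) k - Z) \<le> e" using M elim k by blast
          next
            show "q \<le> real (Suc (r n)) * h (r n)" using pq unfolding hT by simp
          qed (use pq h0 step in \<open>auto simp: h_def simp del: of_nat_Suc\<close>)
        qed
      qed
      show ?thesis
      proof (intro exI[of _ "d / 2"] conjI ballI impI)
        fix s assume s: "s \<in> {0..T}" "norm (s - t) < d / 2"
        show "norm (f s - f t - (s - t) *\<^sub>R Z) \<le> e * norm (s - t)"
        proof (cases "t \<le> s")
          case True
          then show ?thesis using main[of t s] s t d by simp
        next
          case False
          then have "norm (f t - f s - (t - s) *\<^sub>R Z) \<le> e * (t - s)"
            using main[of s t] s t d by simp
          moreover have "f t - f s - (t - s) *\<^sub>R Z = - (f s - f t - (s - t) *\<^sub>R Z)"
            by (simp add: algebra_simps)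
          ultimately show ?thesis using False by (metis norm_minus_cancel abs_of_neg
            real_norm_def diff_less_0_iff_less minus_diff_eq not_le)
        qed
      qed (use d in simp)
    qed
    then show "(f has_vector_derivative Z) (at t within {0..T})"
      unfolding has_vector_derivative_def has_derivative_within_alt
      by (auto intro: bounded_linear_scaleR_left)
  qed
qed

subsection \<open>Semicontinuous and convex functions\<close>

text \<open>Without a minimum each \<open>x\<close> has a better point \<open>b x\<close>, and the
  open sets where \<open>f\<close> exceeds \<open>f (b x)\<close> cover \<open>C\<close>. In a
  finite subcover take the least \<open>f (b x)\<close>: the point \<open>b x\<close> lies in some
  \<open>U z\<close>, so \<open>f (b z)\<close> is smaller still.\<close>

lemma lsc_fun_attains_min:
  fixes f :: "'a::topological_space \<Rightarrow> ereal"
  assumes "lsc_fun f" "compact C" "C \<noteq> {}"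
  obtains x where "x \<in> C" "\<And>y. y \<in> C \<Longrightarrow> f x \<le> f y"
proof -
  have "\<exists>x\<in>C. \<forall>y\<in>C. f x \<le> f y"
  proof (rule ccontr)
    assume "\<not> ?thesis"
    then have "\<forall>x\<in>C. \<exists>y\<in>C. f y < f x" by (auto simp: not_le)
    then obtain b where b: "\<And>x. x \<in> C \<Longrightarrow> b x \<in> C \<and> f (b x) < f x" by metis
    have "\<exists>U. open U \<and> x \<in> U \<and> (\<forall>y\<in>U. f (b x) < f y)" if "x \<in> C" for x
      using assms(1) b[OF that] unfolding lsc_fun_def eventually_nhds by blast
    then obtain U where U: "\<And>x. x \<in> C \<Longrightarrow> open (U x) \<and> x \<in> U x \<and> (\<forall>y\<in>U x. f (b x) < f y)"
      by metis
    obtain D where D: "D \<subseteq> C" "finite D" "C \<subseteq> (\<Union>x\<in>D. U x)"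
      by (rule compactE_image[OF assms(2), of C U]) (use U in auto)
    then have "D \<noteq> {}" using assms(3) by auto
    then obtain x where x: "x \<in> D" "\<And>y. y \<in> D \<Longrightarrow> f (b x) \<le> f (b y)"
      using ex_min_if_finite[of "(\<lambda>x. f (b x)) ` D"] D(2) by (auto simp: not_less)
    obtain z where "z \<in> D" "b x \<in> U z" using D b x by blast
    then have "f (b z) < f (b x)" using U D by blast
    then show False using x(2)[OF \<open>z \<in> D\<close>] by simp
  qed
  then show thesis using that by blast
qed

text \<open>Stated on the product space so that it serves twice: to minimise action plus
  \<open>j\<close> over a compact set of triples, and to pass to the limit in the subgradient
  inequality.\<close>

lemma lsc_fun_real_plus:
  assumes j: "lsc_fun j" and fin: "\<And>z. j z \<noteq> - \<infinity>"
  shows "lsc_fun (\<lambda>p. ereal (fst p) + j (snd p))"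
  unfolding lsc_fun_def
proof (intro allI impI)
  fix p :: "real \<times> 'a" and c
  assume c: "c < ereal (fst p) + j (snd p)"
  show "\<forall>\<^sub>F y in nhds p. c < ereal (fst y) + j (snd y)"
  proof (cases c)
    case (real r)
    have "ereal (r - fst p) < j (snd p)"
      using c real by (cases "j (snd p)") auto
    \<comment> \<open>\<open>d\<close> splits the bound \<open>r\<close> into \<open>d\<close> for
      \<open>j\<close> and \<open>r - d\<close> for the real summand, both with strict room.\<close>
    then obtain d where d: "ereal (r - fst p) < ereal d" "ereal d < j (snd p)"
      using ereal_dense2 by blast
    have "\<forall>\<^sub>F z in nhds (snd p). ereal d < j z"
      using j d(2) unfolding lsc_fun_def by blast
    then have "\<forall>\<^sub>F y in nhds p. ereal d < j (snd y)"
      by (rule eventually_compose_filterlim) (auto intro: tendsto_snd filterlim_ident)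
    moreover have "(fst \<longlongrightarrow> fst p) (nhds p)"
      by (auto intro: tendsto_fst filterlim_ident)
    then have "\<forall>\<^sub>F y in nhds p. r - d < fst y"
      by (rule order_tendstoD) (use d in auto)
    ultimately show ?thesis
    proof eventually_elim
      case (elim y)
      then show ?case using real by (cases "j (snd y)") auto
    qed
  next
    case MInf
    have "c < ereal (fst y) + j (snd y)" for y
      using fin[of "snd y"] by (cases "j (snd y)") (auto simp: MInf)
    then show ?thesis by simp
  qed (use c in auto)
qed

lemma GDERIV_along_line:
  assumes "GDERIV f x :> p"
  shows "((\<lambda>s. f (x + s *\<^sub>R d)) has_real_derivative p \<bullet> d) (at 0)"
proof -
  have "(f has_derivative (\<lambda>v. v \<bullet> p)) (at (x + 0 *\<^sub>R d))"
    using assms by (simp add: gderiv_def)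
  moreover have "((\<lambda>s. x + s *\<^sub>R d) has_derivative (\<lambda>s. s *\<^sub>R d)) (at 0)"
    by (auto intro!: derivative_eq_intros)
  ultimately have "((\<lambda>s. f (x + s *\<^sub>R d)) has_derivative (\<lambda>s. (s *\<^sub>R d) \<bullet> p)) (at 0)"
    by (rule has_derivative_compose[rotated])
  moreover have "(\<lambda>s. (s *\<^sub>R d) \<bullet> p) = (*) (p \<bullet> d)"
    by (auto simp: inner_commute)
  ultimately show ?thesis
    by (simp add: has_field_derivative_def)
qed

text \<open>Chord slopes from \<open>x\<close> towards \<open>y\<close> are at most
  \<open>f y - f x\<close>; let the step tend to 0 from the right. Differentiability is asked at
  \<open>x\<close> alone, so \<open>y\<close> may lie on the boundary of \<open>S\<close>.\<close>

lemma strictly_convex_on_above_tangent: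
  assumes conv: "strictly_convex_on S f" and x: "x \<in> S" and y: "y \<in> S" and D: "GDERIV f x :> p"
  shows "f x + p \<bullet> (y - x) \<le> f y"
proof (cases "x = y")
  case False
  have "((\<lambda>s. (f (x + s *\<^sub>R (y - x)) - f x) / s) \<longlongrightarrow> p \<bullet> (y - x)) (at_right 0)"
    using GDERIV_along_line[OF D, of "y - x"] unfolding has_field_derivative_iff by (auto intro: filterlim_mono at_le)
  moreover have "\<forall>\<^sub>F s in at_right 0. (f (x + s *\<^sub>R (y - x)) - f x) / s \<le> f y - f x"
    unfolding eventually_at_right_field
  proof (intro exI[of _ 1] conjI allI impI)
    fix s :: real assume s: "s > 0" "s < 1"
    have "f ((1 - s) *\<^sub>R x + s *\<^sub>R y) < (1 - s) * f x + s * f y"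
      using conv x y False s unfolding strictly_convex_on_def by blast
    moreover have "(1 - s) *\<^sub>R x + s *\<^sub>R y = x + s *\<^sub>R (y - x)" by (simp add: algebra_simps)
    ultimately show "(f (x + s *\<^sub>R (y - x)) - f x) / s \<le> f y - f x"
      using s by (simp add: field_simps)
  qed simp
  ultimately have "p \<bullet> (y - x) \<le> f y - f x"
    by (rule tendsto_upperbound) simp
  then show ?thesis by simp
qed simp

text \<open>If the limit violated the inequality at some \<open>y\<close>, lower semicontinuity of
  the sum of the pairing and \<open>j\<close> would carry the strict violation to late indices. This
  transfers the boundary inclusion to the limit curve.\<close>

lemma subdifferential_closed:
  fixes j :: "'a::real_inner \<Rightarrow> ereal"
  assumes j: "lsc_fun j" and z: "z \<longlonglongrightarrow> z0" and p: "p \<longlonglongrightarrow> p0"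
    and sub: "\<And>n. p n \<in> subdifferential j (z n)" and fin: "\<And>z. j z \<noteq> - \<infinity>"
  shows "p0 \<in> subdifferential j z0"
  unfolding subdifferential_def
proof (intro CollectI allI)
  fix y
  show "j z0 + ereal (p0 \<bullet> (y - z0)) \<le> j y"
  proof (rule ccontr)
    assume "\<not> ?thesis"
    then have "j y < ereal (p0 \<bullet> (y - z0)) + j z0" by (simp add: add.commute)
    moreover have "lsc_fun (\<lambda>q. ereal (fst q) + j (snd q))"
      by (rule lsc_fun_real_plus[OF j fin])
    ultimately have "\<forall>\<^sub>F q in nhds (p0 \<bullet> (y - z0), z0). j y < ereal (fst q) + j (snd q)"
      unfolding lsc_fun_def by force
    moreover have "(\<lambda>n. (p n \<bullet> (y - z n), z n)) \<longlonglongrightarrow> (p0 \<bullet> (y - z0), z0)"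
      by (intro tendsto_intros z p)
    ultimately have "\<forall>\<^sub>F n in sequentially. j y < ereal (p n \<bullet> (y - z n)) + j (z n)"
      by (auto dest: eventually_compose_filterlim)
    then obtain n where "j y < ereal (p n \<bullet> (y - z n)) + j (z n)"
      by (auto simp: eventually_sequentially)
    moreover have "j (z n) + ereal (p n \<bullet> (y - z n)) \<le> j y"
      using sub[of n] unfolding subdifferential_def by blast
    ultimately show False by (simp add: add.commute)
  qed
qed

subsection \<open>The discretised variational problem\<close>

text \<open>The inverse \<open>\<psi>\<close>, the lower bound \<open>- M\<close> of
  \<open>\<Phi>\<close> and the gradient bound \<open>C\<close> are fixed as parameters, so that
  every later estimate can name its constants and show that they do not depend on the mesh.\<close>

locale bvp =
  fixes T a C M :: real
    and \<phi> \<psi> :: "'v::euclidean_space \<Rightarrow> 'v"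
    and \<Phi> :: "'v \<Rightarrow> real"
    and F :: "real \<Rightarrow> 'v \<Rightarrow> real"
    and g :: "real \<Rightarrow> 'v \<Rightarrow> 'v"
    and j :: "'v \<times> 'v \<Rightarrow> ereal"
  assumes T_pos: "0 < T" and a_pos: "0 < a"
    and homeo: "homeomorphism (ball 0 a) UNIV \<phi> \<psi>"
    and Phi_grad: "\<And>x. x \<in> ball 0 a \<Longrightarrow> GDERIV \<Phi> x :> \<phi> x"
    and Phi_nonpos: "\<And>x. x \<in> cball 0 a \<Longrightarrow> \<Phi> x \<le> 0"
    and Phi_lower: "\<And>x. x \<in> cball 0 a \<Longrightarrow> - M \<le> \<Phi> x"
    and Phi_cont: "continuous_on (cball 0 a) \<Phi>"
    and Phi_convex: "strictly_convex_on (cball 0 a) \<Phi>"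
    and F_cont: "continuous_on ({0..T} \<times> UNIV) (\<lambda>(t, x). F t x)"
    and F_grad: "\<And>t x. t \<in> {0..T} \<Longrightarrow> GDERIV (F t) x :> g t x"
    and g_cont: "continuous_on ({0..T} \<times> UNIV) (\<lambda>(t, x). g t x)"
    and F_zero: "\<And>t. t \<in> {0..T} \<Longrightarrow> F t 0 = 0"
    and g_bound: "\<And>t x. t \<in> {0..T} \<Longrightarrow> norm (g t x) \<le> C"
    and F_anticoercive: "filterlim (\<lambda>x. integral {0..T} (\<lambda>t. F t x)) at_bot at_infinity"
    and j_proper: "proper_fun j" and j_convex: "convex_fun j" and j_lsc: "lsc_fun j"
    and j_zero: "j 0 = 0" and j_subdiff_zero: "0 \<in> subdifferential j 0"
begin

lemma C_nonneg: "C \<ge> 0"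
  using g_bound[of 0 0] T_pos order_trans[OF norm_ge_zero] by simp

lemma j_not_MInf: "j z \<noteq> - \<infinity>"
  using j_proper unfolding proper_fun_def by blast

lemma j_nonneg: "0 \<le> j z"
proof -
  have "j 0 + ereal (0 \<bullet> (z - 0)) \<le> j z"
    using j_subdiff_zero unfolding subdifferential_def by blast
  then show ?thesis by (simp add: j_zero zero_ereal_def[symmetric])
qed

lemma F_continuous: "continuous_on {0..T} (\<lambda>t. F t x)"
proof -
  have "continuous_on {0..T} (\<lambda>t. (t, x))" by (intro continuous_intros)
  from continuous_on_compose2[OF F_cont this] show ?thesis by auto
qed

lemma g_continuous: "continuous_on {0..T} (\<lambda>t. g t x)"
proof -
  have "continuous_on {0..T} (\<lambda>t. (t, x))" by (intro continuous_intros)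
  from continuous_on_compose2[OF g_cont this] show ?thesis by auto
qed

lemma F_lipschitz:
  assumes "t \<in> {0..T}"
  shows "\<bar>F t x - F t y\<bar> \<le> C * norm (x - y)"
proof -
  have "norm (F t x - F t y) \<le> C * norm (x - y)"
  proof (rule differentiable_bound)
    fix z :: 'v
    show "(F t has_derivative (\<lambda>v. v \<bullet> g t z)) (at z within UNIV)"
      using F_grad[OF assms] by (simp add: gderiv_def)
    show "onorm (\<lambda>v. v \<bullet> g t z) \<le> C"
    proof (rule onorm_bound[OF C_nonneg])
      fix v
      have "norm (v \<bullet> g t z) \<le> norm v * norm (g t z)"
        using Cauchy_Schwarz_ineq2 by simp
      also have "\<dots> \<le> C * norm v"
        using mult_left_mono[OF g_bound[OF assms] norm_ge_zero] by (simp add: mult.commute)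
      finally show "norm (v \<bullet> g t z) \<le> C * norm v" .
    qed
  qed auto
  then show ?thesis by simp
qed

text \<open>The tangent inequality at \<open>x\<close> is tested at a point \<open>w\<close> of
  length at most \<open>a / 2\<close> in the direction of \<open>\<phi> x\<close>, using that
  \<open>\<Phi>\<close> lies between \<open>- M\<close> and 0. Bounds on the pairing with the
  velocity thereby become bounds on the momentum.\<close>

lemma phi_inner_lower:
  assumes "x \<in> ball 0 a"
  shows "a / 2 * norm (\<phi> x) - M \<le> \<phi> x \<bullet> x"
proof -
  define w where "w = (a / 2) *\<^sub>R sgn (\<phi> x)"
  have w: "w \<in> cball 0 a" using a_pos by (simp add: w_def norm_sgn)
  have "\<Phi> x + \<phi> x \<bullet> (w - x) \<le> \<Phi> w"
    by (rule strictly_convex_on_above_tangent[OF Phi_convex _ w Phi_grad]) (use assms in auto)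
  moreover have "\<phi> x \<bullet> w = a / 2 * norm (\<phi> x)"
    by (cases "\<phi> x = 0") (simp_all add: w_def sgn_div_norm dot_square_norm power2_eq_square)
  moreover have "\<Phi> w \<le> 0" "- M \<le> \<Phi> x" using w assms Phi_nonpos Phi_lower by auto
  ultimately show ?thesis by (simp add: inner_diff_right)
qed

section \<open>The discretised action and its derivatives\<close>

definition dt :: "nat \<Rightarrow> real" where
  "dt n = T / real (Suc n)"

definition cell :: "nat \<Rightarrow> nat \<Rightarrow> real set" where
  "cell n k = {real k * dt n..real (Suc k) * dt n}"

text \<open>Time is integrated over the cell, not sampled: for fixed \<open>x\<close> the cells then
  add up exactly to the integral in the anticoercivity hypothesis.\<close>

definition G :: "nat \<Rightarrow> nat \<Rightarrow> 'v \<Rightarrow> real" where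
  "G n k x = integral (cell n k) (\<lambda>t. F t x)"

definition dG :: "nat \<Rightarrow> nat \<Rightarrow> 'v \<Rightarrow> 'v" where
  "dG n k x = integral (cell n k) (\<lambda>t. g t x)"

definition vel :: "nat \<Rightarrow> (nat \<Rightarrow> 'v) \<Rightarrow> nat \<Rightarrow> 'v" where
  "vel n u k = (u (Suc k) - u k) /\<^sub>R dt n"

text \<open>The potential is evaluated at the left node of each cell. The term \<open>j\<close> is
  kept apart because it may be infinite.\<close>

definition S :: "nat \<Rightarrow> (nat \<Rightarrow> 'v) \<Rightarrow> real" where
  "S n u = (\<Sum>k<Suc n. dt n * \<Phi> (vel n u k) - G n k (u k))"

text \<open>The weak inequality makes the constraint closed, as compactness requires; strictness is
  recovered for minimisers.\<close>

definition admissible :: "nat \<Rightarrow> (nat \<Rightarrow> 'v) \<Rightarrow> bool" where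
  "admissible n u \<longleftrightarrow> (\<forall>k<Suc n. norm (vel n u k) \<le> a)"

lemma dt_pos: "dt n > 0"
  using T_pos by (simp add: dt_def)

lemma dt_total: "real (Suc n) * dt n = T"
  by (simp add: dt_def)

lemma node_le: "k \<le> Suc n \<Longrightarrow> real k * dt n \<le> T"
  using dt_pos[of n] mult_right_mono[of "real k" "real (Suc n)" "dt n"] unfolding dt_total by simp

lemma cell_subset:
  assumes "k < Suc n"
  shows "cell n k \<subseteq> {0..T}"
proof -
  have "real (Suc k) * dt n \<le> T" "0 \<le> real k * dt n"
    using node_le[of "Suc k" n] assms dt_pos[of n] by auto
  then show ?thesis unfolding cell_def by (simp del: of_nat_Suc)
qed

lemma cell_length: "real k * dt n \<le> real (Suc k) * dt n" "real (Suc k) * dt n - real k * dt n = dt n"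
  using dt_pos[of n] by (auto simp: algebra_simps)

lemma F_continuous_cell: "k < Suc n \<Longrightarrow> continuous_on (cell n k) (\<lambda>t. F t x)"
  by (rule continuous_on_subset[OF F_continuous cell_subset])

lemma g_continuous_cell: "k < Suc n \<Longrightarrow> continuous_on (cell n k) (\<lambda>t. g t x)"
  by (rule continuous_on_subset[OF g_continuous cell_subset])

lemma F_integrable_cell: "k < Suc n \<Longrightarrow> (\<lambda>t. F t x) integrable_on cell n k"
  using F_continuous_cell unfolding cell_def by (rule integrable_continuous_interval)

lemma g_integrable_cell: "k < Suc n \<Longrightarrow> (\<lambda>t. g t x) integrable_on cell n k"
  using g_continuous_cell unfolding cell_def by (rule integrable_continuous_interval)

lemma integral_cell_bound:
  fixes f :: "real \<Rightarrow> 'b::banach"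
  assumes "continuous_on (cell n k) f" "\<And>t. t \<in> cell n k \<Longrightarrow> norm (f t) \<le> B"
  shows "norm (integral (cell n k) f) \<le> B * dt n"
  using integral_bound[OF cell_length(1), of k n f B] assms
  unfolding cell_length(2) cell_def by blast

lemma G_lipschitz:
  assumes "k < Suc n"
  shows "\<bar>G n k x - G n k y\<bar> \<le> C * norm (x - y) * dt n"
proof -
  have "G n k x - G n k y = integral (cell n k) (\<lambda>t. F t x - F t y)"
    unfolding G_def by (intro integral_diff[symmetric] F_integrable_cell assms)
  moreover have "norm (integral (cell n k) (\<lambda>t. F t x - F t y)) \<le> C * norm (x - y) * dt n"
    using cell_subset[OF assms] F_lipschitz
    by (intro integral_cell_bound continuous_intros F_continuous_cell assms) auto
  ultimately show ?thesis by simp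
qed

text \<open>Used with \<open>c = 0\<close> to bound \<open>dG\<close>, and with \<open>c\<close> the
  limiting force to prove that the discrete equation is consistent.\<close>

lemma dG_near:
  assumes "k < Suc n" "\<And>t. t \<in> cell n k \<Longrightarrow> norm (g t x - c) \<le> e"
  shows "norm (dG n k x - dt n *\<^sub>R c) \<le> e * dt n"
proof -
  have ci: "(\<lambda>_. c) integrable_on cell n k"
    by (simp add: cell_def integrable_continuous_interval)
  have "integral (cell n k) (\<lambda>t. c) = dt n *\<^sub>R c"
    unfolding cell_def using cell_length[of k n] by (metis integral_const_real content_real)
  then have "dG n k x - dt n *\<^sub>R c = integral (cell n k) (\<lambda>t. g t x - c)"
    unfolding dG_def using integral_diff[OF g_integrable_cell[OF assms(1)] ci, of x] by simp
  also have "norm \<dots> \<le> e * dt n"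
    by (intro integral_cell_bound continuous_intros g_continuous_cell assms)
  finally show ?thesis .
qed

lemma norm_dG_le:
  assumes "k < Suc n"
  shows "norm (dG n k x) \<le> C * dt n"
  using dG_near[OF assms, of x 0 C] cell_subset[OF assms] g_bound by (auto simp: subset_iff)

lemma G_along_line:
  assumes k: "k < Suc n"
  shows "((\<lambda>s. G n k (x + s *\<^sub>R d)) has_real_derivative dG n k x \<bullet> d) (at 0)"
proof -
  have "((\<lambda>s. integral (cbox (real k * dt n) (real (Suc k) * dt n)) ((\<lambda>s t. F t (x + s *\<^sub>R d)) s))
      has_real_derivative integral (cbox (real k * dt n) (real (Suc k) * dt n))
        ((\<lambda>s t. g t (x + s *\<^sub>R d) \<bullet> d) 0)) (at 0 within UNIV)"
  proof (rule leibniz_rule_field_derivative)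
    fix s t assume "t \<in> cbox (real k * dt n) (real (Suc k) * dt n)"
    then have t: "t \<in> {0..T}" using cell_subset[OF k] by (auto simp: cell_def)
    \<comment> \<open>The chain rule along a line gives a derivative at 0 only, so the line is based
      at the shifted point and then reparametrised.\<close>
    have "((\<lambda>r. F t ((x + s *\<^sub>R d) + r *\<^sub>R d)) has_real_derivative g t (x + s *\<^sub>R d) \<bullet> d) (at 0)"
      by (rule GDERIV_along_line[OF F_grad[OF t]])
    then have "((\<lambda>r. F t (x + r *\<^sub>R d)) has_real_derivative g t (x + s *\<^sub>R d) \<bullet> d) (at (0 + s))"
      unfolding DERIV_shift by (simp add: algebra_simps)
    then show "((\<lambda>s. F t (x + s *\<^sub>R d)) has_real_derivative g t (x + s *\<^sub>R d) \<bullet> d) (at s within UNIV)"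
      by simp
  next
    fix s show "(\<lambda>t. F t (x + s *\<^sub>R d)) integrable_on cbox (real k * dt n) (real (Suc k) * dt n)"
      using F_integrable_cell[OF k] by (simp add: cell_def)
  next
    have "continuous_on (UNIV \<times> cell n k) (\<lambda>p. (snd p, x + fst p *\<^sub>R d))"
      by (intro continuous_intros)
    moreover have "(\<lambda>p. (snd p, x + fst p *\<^sub>R d)) ` (UNIV \<times> cell n k) \<subseteq> {0..T} \<times> UNIV"
      using cell_subset[OF k] by auto
    ultimately have "continuous_on (UNIV \<times> cell n k) (\<lambda>p. g (snd p) (x + fst p *\<^sub>R d))"
      using continuous_on_compose2[OF g_cont] by fastforce
    then show "continuous_on (UNIV \<times> cbox (real k * dt n) (real (Suc k) * dt n))
        (\<lambda>(s, t). g t (x + s *\<^sub>R d) \<bullet> d)"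
      unfolding case_prod_unfold cell_def box_real
      by (rule continuous_on_inner[OF _ continuous_on_const])
  qed auto
  moreover have "integral (cell n k) (\<lambda>t. g t x \<bullet> d) = dG n k x \<bullet> d"
    using integral_linear[OF g_integrable_cell[OF k] bounded_linear_inner_left, of d x]
    by (simp add: dG_def o_def)
  ultimately show ?thesis by (simp add: G_def cell_def)
qed

lemma sum_G: "(\<Sum>k<Suc n. G n k x) = integral {0..T} (\<lambda>t. F t x)"
proof -
  have "(\<Sum>k<m. G n k x) = integral {0..real m * dt n} (\<lambda>t. F t x)" if "m \<le> Suc n" for m
    using that
  proof (induction m)
    case (Suc m)
    have int: "(\<lambda>t. F t x) integrable_on {0..real (Suc m) * dt n}"
      using node_le[OF Suc.prems]
      by (intro integrable_continuous_interval continuous_on_subset[OF F_continuous]) auto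
    have "integral {0..real m * dt n} (\<lambda>t. F t x) + integral {real m * dt n..real (Suc m) * dt n} (\<lambda>t. F t x)
        = integral {0..real (Suc m) * dt n} (\<lambda>t. F t x)"
      by (rule Henstock_Kurzweil_Integration.integral_combine[OF _ _ int])
        (use dt_pos[of n] in \<open>auto simp: algebra_simps\<close>)
    then show ?case using Suc by (simp add: G_def cell_def)
  qed simp
  from this[of "Suc n"] show ?thesis unfolding dt_total by simp
qed

lemma step_eq: "u (Suc k) - u k = dt n *\<^sub>R vel n u k"
  using dt_pos[of n] by (simp add: vel_def)

section \<open>Coercivity and existence of discrete minimisers\<close>

lemma admissible_dist:
  assumes "admissible n u" "k \<le> Suc n"
  shows "norm (u k - u 0) \<le> a * T"
proof -
  have "norm (u k - u 0) \<le> real k * (a * dt n)"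
    using assms(2)
  proof (induction k)
    case (Suc k)
    have "norm (u (Suc k) - u k) \<le> a * dt n"
      using assms(1) Suc.prems dt_pos[of n]
      by (simp add: step_eq[of u k n] admissible_def mult.commute mult_right_mono)
    then have "norm (u (Suc k) - u 0) \<le> a * dt n + norm (u k - u 0)"
      using norm_triangle_ineq[of "u (Suc k) - u k" "u k - u 0"] by simp
    then show ?case using Suc by (simp add: algebra_simps)
  qed simp
  also have "\<dots> \<le> a * T"
    using node_le[OF assms(2)] a_pos by (simp add: mult.left_commute)
  finally show ?thesis .
qed

text \<open>Moving every position back to \<open>u 0\<close> changes the potential by at most
  \<open>C * (a * T)\<close> per unit time, after which the cells sum to one integral. The bound
  does not involve the mesh.\<close>

lemma S_lower:
  assumes "admissible n u"
  shows "- M * T - C * (a * T) * T - integral {0..T} (\<lambda>t. F t (u 0)) \<le> S n u"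
proof -
  have "(\<Sum>k<Suc n. - M * dt n - C * (a * T) * dt n - G n k (u 0)) \<le> S n u"
    unfolding S_def
  proof (rule sum_mono)
    fix k assume "k \<in> {..<Suc n}"
    then have k: "k < Suc n" by simp
    have "vel n u k \<in> cball 0 a" using assms k by (simp add: admissible_def)
    then have "dt n * - M \<le> dt n * \<Phi> (vel n u k)"
      using dt_pos[of n] Phi_lower by (intro mult_left_mono) auto
    moreover have "\<bar>G n k (u k) - G n k (u 0)\<bar> \<le> C * norm (u k - u 0) * dt n"
      by (rule G_lipschitz[OF k])
    moreover have "C * norm (u k - u 0) * dt n \<le> C * (a * T) * dt n"
      using admissible_dist[OF assms, of k] k dt_pos[of n] C_nonneg
      by (intro mult_right_mono mult_left_mono) auto
    ultimately show "- M * dt n - C * (a * T) * dt n - G n k (u 0) \<le> dt n * \<Phi> (vel n u k) - G n k (u k)"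
      by (simp add: mult.commute)
  qed
  also have "(\<Sum>k<Suc n. - M * dt n - C * (a * T) * dt n - G n k (u 0)) =
      (- M - C * (a * T)) * (real (Suc n) * dt n) - integral {0..T} (\<lambda>t. F t (u 0))"
    unfolding sum_subtractf sum_G by (simp add: algebra_simps)
  finally show ?thesis unfolding dt_total by (simp add: algebra_simps)
qed

lemma admissible_zero: "admissible n (\<lambda>_. 0)"
  using a_pos by (simp add: admissible_def vel_def)

lemma S_zero: "S n (\<lambda>_. 0) \<le> 0"
proof -
  have "G n k 0 = 0" if "k < Suc n" for k
    unfolding G_def using cell_subset[OF that] F_zero
    by (subst Henstock_Kurzweil_Integration.integral_cong[of _ _ "\<lambda>_. 0"]) auto
  moreover have "dt n * \<Phi> 0 \<le> 0"
    using dt_pos[of n] Phi_nonpos[of 0] a_pos by (simp add: mult_nonneg_nonpos)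
  ultimately show ?thesis
    unfolding S_def by (intro sum_nonpos) (auto simp: vel_def)
qed

text \<open>\<open>R\<close> is chosen before \<open>n\<close>, so one ball of initial points serves
  all meshes.\<close>

lemma coercive:
  obtains R where "R > 0" "\<And>n u. admissible n u \<Longrightarrow> norm (u 0) > R \<Longrightarrow> S n u > 0"
proof -
  have "\<forall>\<^sub>F x in at_infinity. integral {0..T} (\<lambda>t. F t x) < - M * T - C * (a * T) * T"
    using F_anticoercive by (auto simp: filterlim_at_bot_dense)
  then obtain b where b: "\<And>x. norm x \<ge> b \<Longrightarrow> integral {0..T} (\<lambda>t. F t x) < - M * T - C * (a * T) * T"
    unfolding eventually_at_infinity by blast
  show thesis
  proof (rule that[of "max b 1"])
    fix n u assume "admissible n u" "norm (u 0) > max b 1"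
    then show "S n u > 0" using S_lower[of n u] b[of "u 0"] by simp
  qed simp
qed

text \<open>The direct method on a compact set of sequences with initial point in the ball of radius
  \<open>R\<close>; the zero curve beats every admissible curve starting outside it.\<close>

lemma exists_minimizer:
  assumes R: "R > 0" "\<And>u. admissible n u \<Longrightarrow> norm (u 0) > R \<Longrightarrow> S n u > 0"
  obtains u where "admissible n u" "norm (u 0) \<le> R"
    "\<And>w. admissible n w \<Longrightarrow> ereal (S n u) + j (u 0, u (Suc n)) \<le> ereal (S n w) + j (w 0, w (Suc n))"
proof -
  \<comment> \<open>Nodes beyond \<open>Suc n\<close> do not affect the functional; fixing them at 0
    keeps \<open>K\<close> inside a product of balls.\<close>
  define K where "K = {u. admissible n u \<and> norm (u 0) \<le> R \<and> (\<forall>k>Suc n. u k = 0)}"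
  have coord: "continuous_on A (\<lambda>u::nat \<Rightarrow> 'v. u k)" for A k
    by (rule continuous_on_subset[OF continuous_on_product_coordinates]) simp
  have velc: "continuous_on A (\<lambda>u. vel n u k)" for A k
    unfolding vel_def by (intro continuous_intros coord)
  \<comment> \<open>Tychonoff's theorem, in the topology of pointwise convergence of
    sequences.\<close>
  have "compactin (product_topology (\<lambda>_. euclidean) UNIV) (PiE UNIV (\<lambda>k::nat. cball (0::'v) (R + a * T)))"
    by (simp add: compactin_PiE)
  then have "compact (PiE UNIV (\<lambda>k::nat. cball (0::'v) (R + a * T)))"
    using euclidean_product_topology compactin_euclidean_iff by metis
  moreover have "closed K"
  proof -
    have "closed {u. norm (vel n u k) \<le> a}" "closed {u. norm ((u::nat \<Rightarrow> 'v) 0) \<le> R}" for k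
      by (rule closed_Collect_le[OF continuous_on_norm[OF velc] continuous_on_const])
        (rule closed_Collect_le[OF continuous_on_norm[OF coord] continuous_on_const])
    moreover have "closed {u. (u::nat \<Rightarrow> 'v) k = 0}" for k
      by (rule closed_Collect_eq[OF coord continuous_on_const])
    ultimately have "closed ((\<Inter>k\<in>{..<Suc n}. {u. norm (vel n u k) \<le> a}) \<inter> {u. norm (u 0) \<le> R} \<inter>
        (\<Inter>k\<in>{Suc n<..}. {u. u k = 0}))"
      by (intro closed_Int closed_INT ballI)
    moreover have "K = (\<Inter>k\<in>{..<Suc n}. {u. norm (vel n u k) \<le> a}) \<inter> {u. norm (u 0) \<le> R} \<inter>
        (\<Inter>k\<in>{Suc n<..}. {u. u k = 0})"
      unfolding K_def admissible_def by blast
    ultimately show ?thesis by simp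
  qed
  moreover have "K \<subseteq> PiE UNIV (\<lambda>k::nat. cball (0::'v) (R + a * T))"
  proof
    fix u assume u: "u \<in> K"
    have "norm (u k) \<le> R + a * T" for k
    proof (cases "k \<le> Suc n")
      case True
      then show ?thesis
        using admissible_dist[of n u k] u norm_triangle_sub[of "u k" "u 0"] by (auto simp: K_def)
    qed (use u R T_pos a_pos in \<open>auto simp: K_def\<close>)
    then show "u \<in> PiE UNIV (\<lambda>k::nat. cball (0::'v) (R + a * T))" by auto
  qed
  ultimately have "compact K"
    using compact_Int_closed by (metis inf.absorb_iff2)
  moreover have "continuous_on K (S n)"
    unfolding S_def
  proof (intro continuous_intros)
    fix k assume "k \<in> {..<Suc n}"
    then have k: "k < Suc n" by simp
    show "continuous_on K (\<lambda>u. \<Phi> (vel n u k))"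
      by (rule continuous_on_compose2[OF Phi_cont velc]) (use k in \<open>auto simp: K_def admissible_def\<close>)
    have "(C * dt n)-lipschitz_on UNIV (G n k)"
      by (rule lipschitz_onI)
        (use G_lipschitz[OF k] C_nonneg dt_pos[of n] in \<open>auto simp: dist_norm algebra_simps\<close>)
    then show "continuous_on K (\<lambda>u. G n k (u k))"
      by (intro continuous_on_compose2[OF lipschitz_on_continuous_on coord]) auto
  qed
  \<comment> \<open>Since \<open>j\<close> is only lower semicontinuous, the minimum is sought on
    the compact image of \<open>K\<close> under action and end points.\<close>
  ultimately have "compact ((\<lambda>u. (S n u, u 0, u (Suc n))) ` K)"
    by (intro compact_continuous_image continuous_intros coord)
  moreover have zK: "(\<lambda>_. 0) \<in> K" using R by (auto simp: K_def admissible_zero)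
  then have "(\<lambda>u. (S n u, u 0, u (Suc n))) ` K \<noteq> {}" by blast
  ultimately have "\<exists>p\<in>(\<lambda>u. (S n u, u 0, u (Suc n))) ` K. \<forall>q\<in>(\<lambda>u. (S n u, u 0, u (Suc n))) ` K.
      ereal (fst p) + j (snd p) \<le> ereal (fst q) + j (snd q)"
    by (rule lsc_fun_attains_min[OF lsc_fun_real_plus[OF j_lsc j_not_MInf]]) blast
  then obtain p where p: "p \<in> (\<lambda>u. (S n u, u 0, u (Suc n))) ` K"
    "\<And>q. q \<in> (\<lambda>u. (S n u, u 0, u (Suc n))) ` K \<Longrightarrow> ereal (fst p) + j (snd p) \<le> ereal (fst q) + j (snd q)"
    by blast
  then obtain u where u: "u \<in> K" "p = (S n u, u 0, u (Suc n))" by blast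
  have min: "ereal (S n u) + j (u 0, u (Suc n)) \<le> ereal (S n w) + j (w 0, w (Suc n))" if "w \<in> K" for w
    using p(2)[of "(S n w, w 0, w (Suc n))"] that u by auto
  show thesis
  proof (rule that)
    fix w assume w: "admissible n w"
    show "ereal (S n u) + j (u 0, u (Suc n)) \<le> ereal (S n w) + j (w 0, w (Suc n))"
    proof (cases "norm (w 0) \<le> R")
      case True
      define w' where "w' k = (if k \<le> Suc n then w k else 0)" for k
      have v: "vel n w' k = vel n w k" if "k < Suc n" for k
        using that by (simp add: vel_def w'_def)
      then have "w' \<in> K"
        using w True by (auto simp: K_def admissible_def w'_def)
      moreover have "S n w' = S n w"
        unfolding S_def by (intro sum.cong) (auto simp: v w'_def)
      ultimately show ?thesis using min[of w'] by (simp add: w'_def)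
    next
      case False
      \<comment> \<open>The zero curve has value at most 0, whereas here the action of
        \<open>w\<close> is positive and \<open>j\<close> is nonnegative.\<close>
      have "ereal (S n u) + j (u 0, u (Suc n)) \<le> ereal (S n (\<lambda>_. 0)) + j (0, 0)"
        using min[OF zK] by simp
      also have "\<dots> \<le> 0" using S_zero j_zero by (simp add: zero_prod_def)
      also have "0 \<le> ereal (S n w) + j (w 0, w (Suc n))"
        using R(2)[OF w] False j_nonneg by (intro add_nonneg_nonneg) auto
      finally show ?thesis .
    qed
  qed (use u in \<open>auto simp: K_def\<close>)
qed

section \<open>Strict speed bound for minimisers\<close>

lemma phi_psi [simp]: "\<phi> (\<psi> y) = y"
  using homeo by (simp add: homeomorphism_def)

lemma psi_phi: "x \<in> ball 0 a \<Longrightarrow> \<psi> (\<phi> x) = x"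
  using homeo by (simp add: homeomorphism_def)

lemma norm_psi: "norm (\<psi> y) < a"
  using homeo by (auto simp: homeomorphism_def)

lemma psi_continuous: "continuous_on A \<psi>"
  using homeo continuous_on_subset by (auto simp: homeomorphism_def)

lemma M_nonneg: "M \<ge> 0"
  using Phi_lower[of 0] Phi_nonpos[of 0] a_pos by simp

lemma vel_scaleR: "vel n (\<lambda>k. c *\<^sub>R u k) k = c *\<^sub>R vel n u k"
  by (simp add: vel_def scaleR_diff_right mult.commute)

lemma vel_add_scaleR: "vel n (\<lambda>k. u k + c *\<^sub>R w k) k = vel n u k + c *\<^sub>R vel n w k"
  by (simp add: vel_def algebra_simps)

text \<open>Convexity between \<open>v\<close> and 0. This crude bound serves every cell; the case
  \<open>v = 0\<close> is separate because strict convexity speaks of distinct points.\<close>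

lemma Phi_shrink:
  assumes v: "v \<in> cball 0 a" and s: "0 < s" "s < 1"
  shows "\<Phi> ((1 - s) *\<^sub>R v) - \<Phi> v \<le> s * M"
proof (cases "v = 0")
  case False
  have "\<Phi> ((1 - s) *\<^sub>R v + s *\<^sub>R 0) < (1 - s) * \<Phi> v + s * \<Phi> 0"
    using Phi_convex v False s a_pos unfolding strictly_convex_on_def
    by (metis centre_in_cball less_imp_le)
  also have "\<dots> \<le> \<Phi> v + s * M"
    using mult_left_mono[of "\<Phi> 0 - \<Phi> v" M s] Phi_lower[OF v] Phi_nonpos[of 0] a_pos s
    by (simp add: algebra_simps)
  finally show ?thesis by simp
qed (use s M_nonneg in simp)

lemma shrink_ball:
  fixes v :: 'v
  assumes v: "v \<in> cball 0 a" and s: "0 < s" "s < 1"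
  shows "(1 - s) *\<^sub>R v \<in> ball 0 a"
proof -
  have "(1 - s) * norm v \<le> (1 - s) * a" using v s by (intro mult_left_mono) auto
  also have "\<dots> < a" using s a_pos by (simp add: algebra_simps)
  finally show ?thesis using s by simp
qed

text \<open>The tangent is taken at the shrunk point, which is interior even when \<open>v\<close>
  lies on the sphere of radius \<open>a\<close>.\<close>

lemma Phi_shrink_gradient:
  assumes v: "v \<in> cball 0 a" and s: "0 < s" "s < 1"
  shows "\<Phi> ((1 - s) *\<^sub>R v) - \<Phi> v \<le> - s * (\<phi> ((1 - s) *\<^sub>R v) \<bullet> v)"
proof -
  have b: "(1 - s) *\<^sub>R v \<in> ball 0 a" by (rule shrink_ball[OF assms])
  have "\<Phi> ((1 - s) *\<^sub>R v) + \<phi> ((1 - s) *\<^sub>R v) \<bullet> (v - (1 - s) *\<^sub>R v) \<le> \<Phi> v"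
    by (rule strictly_convex_on_above_tangent[OF Phi_convex _ v Phi_grad[OF b]]) (use b in auto)
  moreover have "v - (1 - s) *\<^sub>R v = s *\<^sub>R v" by (simp add: algebra_simps)
  ultimately show ?thesis by simp
qed

lemma j_segment:
  assumes "j z = ereal J" "j z' = ereal J'" "0 < s" "s < 1"
  shows "j ((1 - s) *\<^sub>R z + s *\<^sub>R z') \<le> ereal ((1 - s) * J + s * J')"
  using j_convex assms unfolding convex_fun_def by (metis plus_ereal.simps(1) times_ereal.simps(1))

definition minimizer :: "nat \<Rightarrow> (nat \<Rightarrow> 'v) \<Rightarrow> bool" where
  "minimizer n u \<longleftrightarrow> admissible n u \<and>
    (\<forall>w. admissible n w \<longrightarrow> ereal (S n u) + j (u 0, u (Suc n)) \<le> ereal (S n w) + j (w 0, w (Suc n)))"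

lemma minimizerD:
  assumes "minimizer n u" "admissible n w"
  shows "ereal (S n u) + j (u 0, u (Suc n)) \<le> ereal (S n w) + j (w 0, w (Suc n))"
  using assms by (simp add: minimizer_def)

lemma minimizer_finite:
  assumes "minimizer n u"
  obtains J where "j (u 0, u (Suc n)) = ereal J" "J \<ge> 0"
proof -
  have "ereal (S n u) + j (u 0, u (Suc n)) \<le> ereal (S n (\<lambda>_. 0)) + j (0, 0)"
    by (rule minimizerD[OF assms admissible_zero])
  then have "ereal (S n u) + j (u 0, u (Suc n)) \<le> ereal (S n (\<lambda>_. 0))"
    using j_zero by (simp add: zero_prod_def)
  then show thesis
    using that j_nonneg[of "(u 0, u (Suc n))"] by (cases "j (u 0, u (Suc n))") auto
qed

text \<open>If cell \<open>l\<close> had speed \<open>a\<close>, comparison with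
  \<open>(1 - s) u\<close> would bound the pairing of \<open>\<phi> ((1 - s) v)\<close> with
  \<open>v\<close> as \<open>s\<close> tends to 0, where \<open>v\<close> is the velocity in that
  cell. Then \<open>\<phi> ((1 - s) v)\<close> is bounded, so \<open>(1 - s) v\<close> and its limit
  \<open>v\<close> stay in a compact subset of the open ball.\<close>

lemma minimizer_interior:
  assumes min: "minimizer n u" and l: "l < Suc n"
  shows "norm (vel n u l) < a"
proof (rule ccontr)
  assume not: "\<not> ?thesis"
  have adm: "norm (vel n u k) \<le> a" if "k < Suc n" for k
    using min that by (simp add: minimizer_def admissible_def)
  then have na: "norm (vel n u l) = a" using not l by fastforce
  obtain J where J: "j (u 0, u (Suc n)) = ereal J" "J \<ge> 0"
    using minimizer_finite[OF min] .
  \<comment> \<open>\<open>s * A k\<close> bounds the cost of shrinking in cell \<open>k\<close>: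
    \<open>M\<close> for the kinetic term, \<open>C\<close> for the potential. \<open>B\<close> may
    depend on \<open>n\<close>, which is fixed here.\<close>
  define A where "A k = M * dt n + C * norm (u k) * dt n" for k
  define B where "B = (\<Sum>k<Suc n. A k) / dt n"
  have "A k \<ge> 0" for k using M_nonneg C_nonneg dt_pos[of n] by (simp add: A_def)
  then have B0: "B \<ge> 0" using dt_pos[of n] by (simp add: B_def sum_nonneg)
  have bound: "norm (\<phi> ((1 - s) *\<^sub>R vel n u l)) \<le> 2 * (B + M) / a" if s: "0 < s" "s < 1" for s
  proof -
    define w where "w k = (1 - s) *\<^sub>R u k" for k
    define X where "X = \<phi> ((1 - s) *\<^sub>R vel n u l) \<bullet> vel n u l"
    have vw: "vel n w k = (1 - s) *\<^sub>R vel n u k" for k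
      unfolding w_def by (rule vel_scaleR)
    have "admissible n w"
      unfolding admissible_def
    proof (intro allI impI)
      fix k assume "k < Suc n"
      then show "norm (vel n w k) \<le> a"
        using adm[of k] s mult_left_le_one_le[of "norm (vel n u k)" "1 - s"] by (simp add: vw)
    qed
    then have "ereal (S n u) + ereal J \<le> ereal (S n w) + j (w 0, w (Suc n))"
      using minimizerD[OF min] J(1) by metis
    \<comment> \<open>Shrinking moves the end points towards 0, where \<open>j\<close> vanishes. As
      \<open>J\<close> is nonnegative, \<open>j\<close> does not increase and drops out.\<close>
    also have "j (w 0, w (Suc n)) \<le> ereal ((1 - s) * J)"
      using j_segment[OF J(1), of 0 0 s] j_zero s by (simp add: w_def zero_ereal_def)
    finally have "S n u + J \<le> S n w + (1 - s) * J" by (simp add: add_left_mono)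
    then have "S n u \<le> S n w" using J(2) s by (simp add: algebra_simps) (smt (verit) mult_nonneg_nonneg)
    then have "0 \<le> (\<Sum>k<Suc n. (dt n * \<Phi> (vel n w k) - G n k (w k)) - (dt n * \<Phi> (vel n u k) - G n k (u k)))"
      unfolding S_def sum_subtractf by simp
    also have "\<dots> \<le> (\<Sum>k<Suc n. s * A k - (if k = l then s * dt n * X else 0))"
    proof (rule sum_mono)
      fix k assume "k \<in> {..<Suc n}"
      then have k: "k < Suc n" by simp
      then have vk: "vel n u k \<in> cball 0 a" using adm by simp
      have "norm (w k - u k) = s * norm (u k)"
        using s by (simp add: w_def scaleR_left_diff_distrib)
      then have "G n k (u k) - G n k (w k) \<le> s * (C * norm (u k) * dt n)"
        using G_lipschitz[OF k, of "w k" "u k"] by (simp add: algebra_simps)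
      moreover have "dt n * (\<Phi> (vel n w k) - \<Phi> (vel n u k)) \<le> dt n * (s * M)"
        using Phi_shrink[OF vk s] dt_pos[of n] by (intro mult_left_mono) (auto simp: vw)
      moreover have "dt n * (\<Phi> (vel n w k) - \<Phi> (vel n u k)) \<le> dt n * (- s * X)" if "k = l"
        using Phi_shrink_gradient[OF vk s] dt_pos[of n] that
        by (intro mult_left_mono) (auto simp: vw X_def)
      \<comment> \<open>Slack for cell \<open>l\<close>: it uses the gradient bound, but its
        \<open>A k\<close> still contains the kinetic cost.\<close>
      moreover have "0 \<le> s * (M * dt n)" using s M_nonneg dt_pos[of n] by simp
      ultimately show "(dt n * \<Phi> (vel n w k) - G n k (w k)) - (dt n * \<Phi> (vel n u k) - G n k (u k))
          \<le> s * A k - (if k = l then s * dt n * X else 0)"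
        by (auto simp: A_def algebra_simps)
    qed
    also have "\<dots> = s * dt n * (B - X)"
      using l dt_pos[of n]
      by (simp add: sum_subtractf sum_distrib_left[symmetric] B_def right_diff_distrib del: sum.lessThan_Suc)
    finally have "0 \<le> s * dt n * (B - X)" .
    then have "X \<le> B" using s dt_pos[of n] by (smt (verit) mult_pos_neg mult_pos_pos)
    have ball: "(1 - s) *\<^sub>R vel n u l \<in> ball 0 a"
      by (rule shrink_ball) (use na s in auto)
    \<comment> \<open>\<open>X\<close> pairs with the full velocity, while
      \<open>phi_inner_lower\<close> pairs with the shrunk one; the factor \<open>1 - s\<close> is
      harmless since \<open>B\<close> is nonnegative.\<close>
    have "(1 - s) * X \<le> (1 - s) * B" using \<open>X \<le> B\<close> s by (intro mult_left_mono) auto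
    also have "\<dots> \<le> B" using B0 s by (simp add: algebra_simps)
    finally have "a / 2 * norm (\<phi> ((1 - s) *\<^sub>R vel n u l)) - M \<le> B"
      using phi_inner_lower[OF ball] by (simp add: X_def)
    then show ?thesis using a_pos by (simp add: field_simps)
  qed
  define K where "K = \<psi> ` cball 0 (2 * (B + M) / a)"
  have "compact K"
    unfolding K_def by (intro compact_continuous_image psi_continuous compact_cball)
  then have "closed K" by (rule compact_imp_closed)
  moreover have "\<forall>\<^sub>F s in at_right 0. (1 - s) *\<^sub>R vel n u l \<in> K"
    unfolding eventually_at_right_field
  proof (intro exI[of _ 1] conjI allI impI)
    fix s :: real assume s: "s > 0" "s < 1"
    have "(1 - s) *\<^sub>R vel n u l \<in> ball 0 a"
      by (rule shrink_ball) (use na s in auto)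
    then show "(1 - s) *\<^sub>R vel n u l \<in> K"
      using bound[OF s] psi_phi unfolding K_def by (metis image_eqI mem_cball_0)
  qed simp
  moreover have "((\<lambda>s. (1 - s) *\<^sub>R vel n u l) \<longlongrightarrow> (1 - 0) *\<^sub>R vel n u l) (at_right 0)"
    by (intro tendsto_intros)
  ultimately have "(1 - 0) *\<^sub>R vel n u l \<in> K"
    by (intro Lim_in_closed_set) auto
  then obtain x where "vel n u l = \<psi> x" by (auto simp: K_def)
  then show False using na norm_psi[of x] by simp
qed

section \<open>Discrete Euler-Lagrange equation and boundary inclusion\<close>

lemma S_along_line:
  assumes int: "\<And>k. k < Suc n \<Longrightarrow> norm (vel n u k) < a"
  shows "((\<lambda>s. S n (\<lambda>k. u k + s *\<^sub>R w k)) has_real_derivative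
    (\<Sum>k<Suc n. \<phi> (vel n u k) \<bullet> (w (Suc k) - w k) - dG n k (u k) \<bullet> w k)) (at 0)"
  unfolding S_def vel_add_scaleR
proof (rule DERIV_sum)
  fix k assume "k \<in> {..<Suc n}"
  then have k: "k < Suc n" by simp
  have "((\<lambda>s. dt n * \<Phi> (vel n u k + s *\<^sub>R vel n w k) - G n k (u k + s *\<^sub>R w k)) has_real_derivative
      dt n * (\<phi> (vel n u k) \<bullet> vel n w k) - dG n k (u k) \<bullet> w k) (at 0)"
    by (intro DERIV_diff DERIV_cmult GDERIV_along_line[OF Phi_grad] G_along_line)
      (use int k in auto)
  then show "((\<lambda>s. dt n * \<Phi> (vel n u k + s *\<^sub>R vel n w k) - G n k (u k + s *\<^sub>R w k)) has_real_derivative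
      \<phi> (vel n u k) \<bullet> (w (Suc k) - w k) - dG n k (u k) \<bullet> w k) (at 0)"
    by (simp add: step_eq[of w k n])
qed

text \<open>As \<open>j\<close> need not be differentiable, it is estimated by its chord towards the
  displaced end points, which contributes exactly \<open>s * (J' - J)\<close>. Dividing minimality
  by \<open>s\<close> leaves the difference quotient of the action.\<close>

lemma minimizer_variation:
  assumes min: "minimizer n u" and J: "j (u 0, u (Suc n)) = ereal J"
    and J': "j (u 0 + w 0, u (Suc n) + w (Suc n)) = ereal J'"
  shows "J - J' \<le> (\<Sum>k<Suc n. \<phi> (vel n u k) \<bullet> (w (Suc k) - w k) - dG n k (u k) \<bullet> w k)"
    (is "_ \<le> ?D")
proof -
  define f where "f s = S n (\<lambda>k. u k + s *\<^sub>R w k)" for s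
  have "(f has_real_derivative ?D) (at 0)"
    unfolding f_def by (rule S_along_line[OF minimizer_interior[OF min]])
  then have "((\<lambda>s. (f s - f 0) / s) \<longlongrightarrow> ?D) (at_right 0)"
    unfolding has_field_derivative_iff by (auto intro: filterlim_mono at_le)
  moreover have "\<forall>\<^sub>F s in at_right 0. J - J' \<le> (f s - f 0) / s"
  proof -
    \<comment> \<open>The strict speed bound lets the curve move in any direction \<open>w\<close>
      for small \<open>s\<close>.\<close>
    have "\<forall>\<^sub>F s in at_right 0. norm (vel n u k + s *\<^sub>R vel n w k) < a" if "k < Suc n" for k
    proof (rule order_tendstoD(2))
      show "((\<lambda>s. norm (vel n u k + s *\<^sub>R vel n w k)) \<longlongrightarrow> norm (vel n u k + 0 *\<^sub>R vel n w k)) (at_right 0)"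
        by (intro tendsto_intros)
    qed (use minimizer_interior[OF min that] in simp)
    then have "\<forall>\<^sub>F s in at_right 0. \<forall>k\<in>{..<Suc n}. norm (vel n u k + s *\<^sub>R vel n w k) < a"
      by (intro eventually_ball_finite) auto
    moreover have "\<forall>\<^sub>F s::real in at_right 0. s \<in> {0<..<1}"
      by (rule eventually_at_right_real) simp
    ultimately show ?thesis
    proof eventually_elim
      case (elim s)
      then have s: "0 < s" "s < 1" by auto
      have "admissible n (\<lambda>k. u k + s *\<^sub>R w k)"
        using elim(1) by (auto simp: admissible_def vel_add_scaleR intro: less_imp_le)
      then have "ereal (S n u) + ereal J \<le> ereal (f s) + j (u 0 + s *\<^sub>R w 0, u (Suc n) + s *\<^sub>R w (Suc n))"
        using minimizerD[OF min] J unfolding f_def by fastforce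
      also have "(u 0 + s *\<^sub>R w 0, u (Suc n) + s *\<^sub>R w (Suc n)) =
          (1 - s) *\<^sub>R (u 0, u (Suc n)) + s *\<^sub>R (u 0 + w 0, u (Suc n) + w (Suc n))"
        by (simp add: algebra_simps)
      also have "j \<dots> \<le> ereal ((1 - s) * J + s * J')"
        by (rule j_segment[OF J J' s])
      finally have "S n u + J \<le> f s + ((1 - s) * J + s * J')" by (simp add: add_left_mono)
      moreover have "f 0 = S n u" by (simp add: f_def)
      ultimately show ?case using s by (simp add: field_simps)
    qed
  qed
  ultimately show ?thesis by (rule tendsto_lowerbound) simp
qed

text \<open>The direction \<open>- u\<close> sends both end points to 0, where \<open>j\<close>
  vanishes, so \<open>j\<close> enters with a favourable sign. The result is an integral bound on
  the momentum that is uniform in \<open>n\<close>.\<close>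

lemma minimizer_momentum_bound:
  assumes min: "minimizer n u" and R: "norm (u 0) \<le> R"
  shows "a / 2 * (\<Sum>k<Suc n. dt n * norm (\<phi> (vel n u k))) \<le> T * (M + C * (R + a * T))"
proof -
  obtain J where J: "j (u 0, u (Suc n)) = ereal J" "J \<ge> 0"
    using minimizer_finite[OF min] .
  have "0 \<le> J - 0" using J by simp
  also have "\<dots> \<le> (\<Sum>k<Suc n. \<phi> (vel n u k) \<bullet> (- u (Suc k) - - u k) - dG n k (u k) \<bullet> - u k)"
    by (rule minimizer_variation[OF min J(1)]) (use j_zero in \<open>simp add: zero_prod_def\<close>)
  also have "\<dots> \<le> (\<Sum>k<Suc n. dt n * (M + C * (R + a * T)) - a / 2 * (dt n * norm (\<phi> (vel n u k))))"
  proof (rule sum_mono)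
    fix k assume "k \<in> {..<Suc n}"
    then have k: "k < Suc n" by simp
    have "norm (u k) \<le> R + a * T"
      using admissible_dist[of n u k] norm_triangle_sub[of "u k" "u 0"] R min k by (simp add: minimizer_def)
    then have "norm (dG n k (u k)) * norm (u k) \<le> C * dt n * (R + a * T)"
      using norm_dG_le[OF k] C_nonneg dt_pos[of n] by (intro mult_mono) auto
    then have "dG n k (u k) \<bullet> u k \<le> C * dt n * (R + a * T)"
      using Cauchy_Schwarz_ineq2[of "dG n k (u k)" "u k"] by simp
    moreover have "dt n * (a / 2 * norm (\<phi> (vel n u k)) - M) \<le> dt n * (\<phi> (vel n u k) \<bullet> vel n u k)"
      using phi_inner_lower minimizer_interior[OF min k] dt_pos[of n] by (intro mult_left_mono) auto
    moreover have "- u (Suc k) - - u k = - (dt n *\<^sub>R vel n u k)"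
      by (subst step_eq[symmetric]) simp
    then have "\<phi> (vel n u k) \<bullet> (- u (Suc k) - - u k) = - (dt n * (\<phi> (vel n u k) \<bullet> vel n u k))"
      by simp
    ultimately show "\<phi> (vel n u k) \<bullet> (- u (Suc k) - - u k) - dG n k (u k) \<bullet> - u k
        \<le> dt n * (M + C * (R + a * T)) - a / 2 * (dt n * norm (\<phi> (vel n u k)))"
      by (simp add: algebra_simps)
  qed
  also have "\<dots> = real (Suc n) * dt n * (M + C * (R + a * T)) - a / 2 * (\<Sum>k<Suc n. dt n * norm (\<phi> (vel n u k)))"
    unfolding sum_subtractf sum_distrib_left[symmetric] by simp
  finally show ?thesis unfolding dt_total by simp
qed

text \<open>Abel summation, indexed so that the factor of \<open>w k\<close> is the residual of the
  discrete equation in cell \<open>k\<close>.\<close>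

lemma sum_by_parts:
  "(\<Sum>k<Suc n. q (Suc k) \<bullet> (w (Suc k) - w k) - c k \<bullet> w k) =
    q (Suc n) \<bullet> w (Suc n) - q 0 \<bullet> w 0 + (\<Sum>k<Suc n. (q k - q (Suc k) - c k) \<bullet> (w k :: 'v))"
proof -
  have "(\<Sum>k<Suc n. q (Suc k) \<bullet> (w (Suc k) - w k) - c k \<bullet> w k) =
      (\<Sum>k<Suc n. (q (Suc k) \<bullet> w (Suc k) - q k \<bullet> w k) + (q k - q (Suc k) - c k) \<bullet> w k)"
    by (intro sum.cong) (auto simp: algebra_simps)
  also have "\<dots> = (\<Sum>k<Suc n. q (Suc k) \<bullet> w (Suc k) - q k \<bullet> w k) + (\<Sum>k<Suc n. (q k - q (Suc k) - c k) \<bullet> w k)"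
    by (rule sum.distrib)
  also have "(\<Sum>k<Suc n. q (Suc k) \<bullet> w (Suc k) - q k \<bullet> w k) = q (Suc n) \<bullet> w (Suc n) - q 0 \<bullet> w 0"
    by (rule sum_lessThan_telescope)
  finally show ?thesis .
qed

text \<open>
  The momentum at node \<open>k + 1\<close> is that of the preceding cell; the value at node 0 is chosen so that the
  discrete equation also holds in the first cell.
\<close>

definition momentum :: "nat \<Rightarrow> (nat \<Rightarrow> 'v) \<Rightarrow> nat \<Rightarrow> 'v" where
  "momentum n u k = (case k of 0 \<Rightarrow> \<phi> (vel n u 0) + dG n 0 (u 0) | Suc i \<Rightarrow> \<phi> (vel n u i))"

text \<open>After summation by parts, testing with the negative residuals forces them to vanish;
  this leaves the end points fixed because the residual in cell 0 is zero by construction. Only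
  boundary terms then remain, and arbitrary end displacements give the subgradient
  inequality.\<close>

lemma
  assumes min: "minimizer n u"
  shows momentum_step: "k < Suc n \<Longrightarrow> momentum n u (Suc k) - momentum n u k = - dG n k (u k)"
    and momentum_boundary: "(momentum n u 0, - momentum n u (Suc n)) \<in> subdifferential j (u 0, u (Suc n))"
proof -
  obtain J where J: "j (u 0, u (Suc n)) = ereal J" "J \<ge> 0"
    using minimizer_finite[OF min] .
  let ?q = "momentum n u"
  define r where "r k = ?q k - ?q (Suc k) - dG n k (u k)" for k
  have var: "J - J' \<le> ?q (Suc n) \<bullet> w (Suc n) - ?q 0 \<bullet> w 0 + (\<Sum>k<Suc n. r k \<bullet> w k)"
    if "j (u 0 + w 0, u (Suc n) + w (Suc n)) = ereal J'" for w J'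
    using minimizer_variation[OF min J(1) that] sum_by_parts[of ?q w "\<lambda>k. dG n k (u k)" n]
    by (simp add: r_def momentum_def)
  have r0: "r 0 = 0" by (simp add: r_def momentum_def)
  have r: "r k = 0" if "k < Suc n" for k
  proof -
    let ?w = "\<lambda>k. if k < Suc n then - r k else 0"
      \<comment> \<open>vanishes at both end nodes because \<open>r 0 = 0\<close>, so the value of \<open>j\<close> is unchanged\<close>
    have "J - J \<le> ?q (Suc n) \<bullet> ?w (Suc n) - ?q 0 \<bullet> ?w 0 + (\<Sum>k<Suc n. r k \<bullet> ?w k)"
      by (rule var) (use J r0 in simp)
    moreover have "(\<Sum>k<Suc n. r k \<bullet> ?w k) = (\<Sum>k<Suc n. - (r k \<bullet> r k))"
      by (intro sum.cong) auto
    ultimately have "(\<Sum>k<Suc n. r k \<bullet> r k) \<le> 0" by (simp add: r0 sum_negf del: sum.lessThan_Suc)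
    then have "\<forall>k\<in>{..<Suc n}. r k \<bullet> r k = 0"
      by (subst sum_nonneg_eq_0_iff[symmetric]) (auto intro!: antisym sum_nonneg simp del: sum.lessThan_Suc)
    then show ?thesis using that by simp
  qed
  show "k < Suc n \<Longrightarrow> ?q (Suc k) - ?q k = - dG n k (u k)"
    using r[of k] by (simp add: r_def algebra_simps)
  show "(?q 0, - ?q (Suc n)) \<in> subdifferential j (u 0, u (Suc n))"
    unfolding subdifferential_def
  proof (intro CollectI allI)
    fix y :: "'v \<times> 'v"
    show "j (u 0, u (Suc n)) + ereal ((?q 0, - ?q (Suc n)) \<bullet> (y - (u 0, u (Suc n)))) \<le> j y"
    proof (cases "j y")
      case (real J')
      \<comment> \<open>Only the end values matter: the residuals vanish, so the values at the nodes
        between are arbitrary.\<close>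
      let ?w = "\<lambda>k::nat. if k = 0 then fst y - u 0 else snd y - u (Suc n)"
      have "J - J' \<le> ?q (Suc n) \<bullet> ?w (Suc n) - ?q 0 \<bullet> ?w 0 + (\<Sum>k<Suc n. r k \<bullet> ?w k)"
        by (rule var) (use real in simp)
      moreover have "(\<Sum>k<Suc n. r k \<bullet> ?w k) = 0"
        by (intro sum.neutral) (auto simp: r)
      ultimately show ?thesis
        unfolding J real by (simp add: inner_prod_def del: sum.lessThan_Suc)
    qed (use j_not_MInf in auto)
  qed
qed

text \<open>Momenta vary by at most \<open>C * T\<close> along the curve, so the integral bound,
  averaged over the cells, bounds the momentum at node 0.\<close>

lemma norm_momentum_0:
  assumes min: "minimizer n u" and R: "norm (u 0) \<le> R"
  shows "norm (momentum n u 0) \<le> 2 / a * (M + C * (R + a * T)) + C * T"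
proof -
  let ?q = "momentum n u"
  have inc: "norm (?q 0) \<le> norm (?q k) + C * dt n * real k" if "k \<le> Suc n" for k
    using that
  proof (induction k)
    case (Suc k)
    have "?q k = ?q (Suc k) + dG n k (u k)"
      using momentum_step[OF min, of k] Suc.prems by (simp add: algebra_simps)
    then have "norm (?q k) \<le> norm (?q (Suc k)) + C * dt n"
      using norm_triangle_ineq[of "?q (Suc k)" "dG n k (u k)"] norm_dG_le[of k n "u k"] Suc.prems by simp
    then show ?case using Suc by (simp add: algebra_simps)
  qed simp
  have "(\<Sum>k<Suc n. dt n * norm (?q 0)) = real (Suc n) * dt n * norm (?q 0)"
    by simp
  then have "T * norm (?q 0) = (\<Sum>k<Suc n. dt n * norm (?q 0))"
    unfolding dt_total by (rule sym)
  also have "\<dots> \<le> (\<Sum>k<Suc n. dt n * norm (\<phi> (vel n u k)) + dt n * (C * T))"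
  proof (rule sum_mono)
    fix k assume "k \<in> {..<Suc n}"
    then have "norm (?q 0) \<le> norm (?q (Suc k)) + C * dt n * real (Suc k)" by (intro inc) simp
    also have "C * dt n * real (Suc k) \<le> C * T"
      using node_le[of "Suc k" n] \<open>k \<in> _\<close> C_nonneg
      by (simp add: mult.assoc mult.commute[of "dt n"] mult_left_mono del: of_nat_Suc)
    finally have "norm (?q 0) \<le> norm (\<phi> (vel n u k)) + C * T" by (simp add: momentum_def)
    then show "dt n * norm (?q 0) \<le> dt n * norm (\<phi> (vel n u k)) + dt n * (C * T)"
      using dt_pos[of n] by (simp add: distrib_left[symmetric])
  qed
  also have "\<dots> = (\<Sum>k<Suc n. dt n * norm (\<phi> (vel n u k))) + real (Suc n) * dt n * (C * T)"
    unfolding sum.distrib by simp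
  also have "\<dots> \<le> T * (2 / a * (M + C * (R + a * T)) + C * T)"
  proof -
    have "x \<le> 2 / a * (T * y)" if "a / 2 * x \<le> T * y" for x y :: real
      using that a_pos by (simp add: field_simps)
    from this[OF minimizer_momentum_bound[OF min R]] show ?thesis
      unfolding dt_total distrib_left by (simp only: mult.left_commute add_right_mono)
  qed
  finally show ?thesis using T_pos by simp
qed

section \<open>Passage to the limit in the discrete equations\<close>

lemma solution_exists: "\<exists>u. is_solution T a \<phi> g j u"
proof -
  obtain R where R: "R > 0" "\<And>n u. admissible n u \<Longrightarrow> norm (u 0) > R \<Longrightarrow> S n u > 0"
    using coercive by blast
  have "\<exists>u. minimizer n u \<and> norm (u 0) \<le> R" for n
    using exists_minimizer[OF R(1), of n] R(2) unfolding minimizer_def by metis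
  then obtain u where min: "\<And>n. minimizer n (u n)" and uR: "\<And>n. norm (u n 0) \<le> R"
    by metis
  define q where "q n = momentum n (u n)" for n
  \<comment> \<open>Position and momentum form one curve, whose steps \<open>Y\<close> discretise
    the first-order system u' = \<open>\<psi>\<close>(q), q' = -\<open>g\<close>(t, u). The velocity
    in cell \<open>k\<close> comes from the momentum at the right node \<open>Suc k\<close>.\<close>
  define X where "X n k = (u n k, q n k)" for n k
  define Y where "Y n k = (\<psi> (q n (Suc k)), - (dG n k (u n k) /\<^sub>R dt n))" for n k
  have psi_q: "\<psi> (q n (Suc k)) = vel n (u n) k" if "k < Suc n" for n k
    using psi_phi minimizer_interior[OF min that] by (simp add: q_def momentum_def)
  have step: "X n (Suc k) - X n k = (T / real (Suc n)) *\<^sub>R Y n k" if k: "k < Suc n" for n k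
    using momentum_step[OF min k] step_eq[of "u n" k n] dt_pos[of n]
    unfolding dt_def[symmetric] by (simp add: X_def Y_def psi_q[OF k, unfolded q_def] q_def)
  have YL: "norm (Y n k) \<le> a + C" if k: "k < Suc n" for n k
  proof -
    have "norm (dG n k (u n k) /\<^sub>R dt n) \<le> C"
      using norm_dG_le[OF k, of "u n k"] dt_pos[of n] by (simp add: field_simps)
    then show ?thesis
      unfolding Y_def using norm_Pair_le[of "\<psi> (q n (Suc k))" "- (dG n k (u n k) /\<^sub>R dt n)"]
        norm_psi[of "q n (Suc k)"] by simp
  qed
  have X0: "norm (X n 0) \<le> R + (2 / a * (M + C * (R + a * T)) + C * T)" for n
    unfolding X_def q_def using norm_Pair_le uR norm_momentum_0[OF min uR] add_mono order_trans by blast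
  show ?thesis
  proof (rule discrete_curves_subconverge[OF T_pos step YL X0, folded dt_def])
    fix f and r :: "nat \<Rightarrow> nat"
    assume r: "strict_mono r" and f: "continuous_on {0..T} f"
      and conv: "\<And>e. e > 0 \<Longrightarrow> \<exists>m. \<forall>n\<ge>m. \<forall>k\<le>Suc (r n). norm (X (r n) k - f (real k * dt (r n))) < e"
      and der: "\<And>t Z. \<lbrakk>t \<in> {0..T}; \<And>e. e > 0 \<Longrightarrow> \<exists>d>0. \<exists>m. \<forall>n\<ge>m. \<forall>k<Suc (r n).
         \<bar>real k * dt (r n) - t\<bar> < d \<longrightarrow> norm (Y (r n) k - Z) \<le> e\<rbrakk>
         \<Longrightarrow> (f has_vector_derivative Z) (at t within {0..T})"
    define U where "U t = fst (f t)" for t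
    define Q where "Q t = snd (f t)" for t
    have U: "continuous_on {0..T} U" and Q: "continuous_on {0..T} Q"
      unfolding U_def Q_def by (intro continuous_intros f)+
    have "dt \<longlonglongrightarrow> 0"
      unfolding dt_def by (intro real_tendsto_divide_at_top[OF tendsto_const]
          filterlim_compose[OF filterlim_real_sequentially filterlim_Suc])
    then have dt_lim: "(\<lambda>n. dt (r n)) \<longlonglongrightarrow> 0"
      using LIMSEQ_subseq_LIMSEQ[OF _ r] by (simp add: o_def)
    have fder: "(f has_vector_derivative (\<psi> (Q t), - g t (U t))) (at t within {0..T})" if t: "t \<in> {0..T}" for t
    proof (rule der[OF t])
      fix e :: real assume "e > 0"
      then have e2: "e / 2 > 0" by simp
      obtain d1 where d1: "d1 > 0" "\<And>x. dist x (Q t) < d1 \<Longrightarrow> dist (\<psi> x) (\<psi> (Q t)) < e / 2"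
        using psi_continuous[of UNIV] e2 unfolding continuous_on_iff by blast
      obtain d2 where d2: "d2 > 0" "\<And>s x. \<lbrakk>s \<in> {0..T}; dist (s, x) (t, U t) < d2\<rbrakk> \<Longrightarrow> dist (g s x) (g t (U t)) < e / 2"
        using g_cont t e2 unfolding continuous_on_iff by fastforce
      define d where "d = min d1 d2"
      have d: "d > 0" using d1 d2 by (simp add: d_def)
      obtain d3 where d3: "d3 > 0" "\<And>s. \<lbrakk>s \<in> {0..T}; dist s t < d3\<rbrakk> \<Longrightarrow> dist (f s) (f t) < d / 4"
        using f t d unfolding continuous_on_iff by (metis divide_pos_pos zero_less_numeral)
      obtain m1 where m1: "\<And>n k. \<lbrakk>n \<ge> m1; k \<le> Suc (r n)\<rbrakk> \<Longrightarrow> norm (X (r n) k - f (real k * dt (r n))) < d / 4"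
        using conv[of "d / 4"] d by auto
      \<comment> \<open>With the mesh width also below \<open>d4\<close>, both nodes of the cell are
        within \<open>2 * d4\<close>, hence within \<open>d3\<close>, of \<open>t\<close>, and every
        time in the cell is within \<open>d / 2\<close> of \<open>t\<close>.\<close>
      define d4 where "d4 = min (d / 4) (d3 / 2)"
      have d4: "d4 > 0" using d d3 by (simp add: d4_def)
      obtain m2 where m2: "\<And>n. n \<ge> m2 \<Longrightarrow> dt (r n) < d4"
        using order_tendstoD(2)[OF dt_lim d4] unfolding eventually_sequentially by blast
      have "norm (Y (r n) k - (\<psi> (Q t), - g t (U t))) \<le> e"
        if n: "n \<ge> max m1 m2" and k: "k < Suc (r n)" and near: "\<bar>real k * dt (r n) - t\<bar> < d4" for n k
      proof -
        have close: "dist (X (r n) i) (f t) < d / 2" if "i \<le> Suc (r n)" "\<bar>real i * dt (r n) - t\<bar> < d3" for i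
        proof -
          have "real i * dt (r n) \<in> {0..T}"
            using node_le[OF that(1)] dt_pos[of "r n"] by simp
          then have "dist (f (real i * dt (r n))) (f t) < d / 4"
            using d3(2) that(2) by (simp add: dist_real_def)
          moreover have "dist (X (r n) i) (f (real i * dt (r n))) < d / 4"
            using m1[of n i] n that(1) by (simp add: dist_norm)
          ultimately show ?thesis
            using dist_triangle[of "X (r n) i" "f t" "f (real i * dt (r n))"] by linarith
        qed
        have sk: "real (Suc k) * dt (r n) = real k * dt (r n) + dt (r n)" by (simp add: algebra_simps)
        have dtn: "0 < dt (r n)" "dt (r n) < d4" using dt_pos m2 n by auto
        \<comment> \<open>Both nodes are needed: the momentum is read at the right one, the position
          at the left one.\<close>
        have "\<bar>real (Suc k) * dt (r n) - t\<bar> < d3" "\<bar>real k * dt (r n) - t\<bar> < d3"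
          using near dtn unfolding sk d4_def by linarith+
        then have "dist (X (r n) (Suc k)) (f t) < d / 2" "dist (X (r n) k) (f t) < d / 2"
          using close[of "Suc k"] close[of k] k by auto
        then have qk: "dist (q (r n) (Suc k)) (Q t) < d1" and uk: "dist (u (r n) k) (U t) < d / 2"
          using dist_snd_le[of "X (r n) (Suc k)" "f t"] dist_fst_le[of "X (r n) k" "f t"] d1(1) d
          by (auto simp: X_def U_def Q_def d_def)
        have "norm (dG (r n) k (u (r n) k) - dt (r n) *\<^sub>R g t (U t)) \<le> e / 2 * dt (r n)"
        proof (rule dG_near[OF k])
          fix s assume s: "s \<in> cell (r n) k"
          then have "real k * dt (r n) \<le> s" "s \<le> real k * dt (r n) + dt (r n)"
            unfolding cell_def sk by auto
          then have "dist s t < d / 2"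
            using near dtn unfolding d4_def dist_real_def by linarith
          then have "dist (s, u (r n) k) (t, U t) < d2"
            using uk norm_Pair_le[of "s - t" "u (r n) k - U t"] by (simp add: dist_norm d_def)
          then show "norm (g s (u (r n) k) - g t (U t)) \<le> e / 2"
            using d2(2) s cell_subset[OF k] by (force simp: dist_norm)
        qed
        moreover have "dG (r n) k (u (r n) k) /\<^sub>R dt (r n) - g t (U t) =
            (dG (r n) k (u (r n) k) - dt (r n) *\<^sub>R g t (U t)) /\<^sub>R dt (r n)"
          using dtn by (simp add: algebra_simps)
        moreover have "norm (x /\<^sub>R c) \<le> b" if "norm x \<le> b * c" "c > 0" for x :: 'v and b c
          using that by (simp add: field_simps)
        ultimately have "norm (dG (r n) k (u (r n) k) /\<^sub>R dt (r n) - g t (U t)) \<le> e / 2"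
          using dtn(1) by metis
        moreover have "norm (\<psi> (q (r n) (Suc k)) - \<psi> (Q t)) < e / 2"
          using d1(2)[OF qk] by (simp add: dist_norm)
        ultimately show ?thesis
          unfolding Y_def using norm_Pair_le[of "\<psi> (q (r n) (Suc k)) - \<psi> (Q t)"
              "g t (U t) - dG (r n) k (u (r n) k) /\<^sub>R dt (r n)"]
            norm_minus_commute[of "g t (U t)"]
          by simp
      qed
      then show "\<exists>d>0. \<exists>m. \<forall>n\<ge>m. \<forall>k<Suc (r n). \<bar>real k * dt (r n) - t\<bar> < d \<longrightarrow>
          norm (Y (r n) k - (\<psi> (Q t), - g t (U t))) \<le> e"
        using d4 by blast
    qed
    have U_der: "(U has_vector_derivative \<psi> (Q t)) (at t within {0..T})"
      and Q_der: "(Q has_vector_derivative - g t (U t)) (at t within {0..T})" if "t \<in> {0..T}" for t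
      using bounded_linear.has_vector_derivative[OF bounded_linear_fst fder[OF that]]
        bounded_linear.has_vector_derivative[OF bounded_linear_snd fder[OF that]]
      by (simp_all add: U_def[abs_def] Q_def[abs_def])
    have gU: "continuous_on {0..T} (\<lambda>t. g t (U t))"
    proof -
      have "continuous_on {0..T} (\<lambda>t. (t, U t))" by (intro continuous_intros U)
      from continuous_on_compose2[OF g_cont this] show ?thesis by auto
    qed
    \<comment> \<open>For the boundary inclusion: node 0 stays at time 0 and the last node, whose
      index moves with \<open>n\<close>, stays at time \<open>T\<close>.\<close>
    have nodes: "(\<lambda>n. X (r n) (i n)) \<longlonglongrightarrow> f s" if i: "\<And>n. i n \<le> Suc (r n)" "\<And>n. real (i n) * dt (r n) = s" for i s
      unfolding LIMSEQ_iff using conv i by metis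
    have X_0: "(\<lambda>n. X (r n) 0) \<longlonglongrightarrow> f 0" and X_T: "(\<lambda>n. X (r n) (Suc (r n))) \<longlonglongrightarrow> f T"
      by (rule nodes; simp add: dt_total del: of_nat_Suc)+
    have bc: "(Q 0, - Q T) \<in> subdifferential j (U 0, U T)"
    proof (rule subdifferential_closed[OF j_lsc])
      show "(\<lambda>n. (u (r n) 0, u (r n) (Suc (r n)))) \<longlonglongrightarrow> (U 0, U T)"
        using tendsto_Pair[OF tendsto_fst[OF X_0] tendsto_fst[OF X_T]] by (simp add: X_def U_def)
      show "(\<lambda>n. (q (r n) 0, - q (r n) (Suc (r n)))) \<longlonglongrightarrow> (Q 0, - Q T)"
        using tendsto_Pair[OF tendsto_snd[OF X_0] tendsto_minus[OF tendsto_snd[OF X_T]]]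
        by (simp add: X_def Q_def)
    qed (use momentum_boundary[OF min] j_not_MInf in \<open>auto simp: q_def\<close>)
    have "is_solution T a \<phi> g j U"
      unfolding is_solution_def
    \<comment> \<open>With velocity \<open>\<psi> (Q t)\<close> the momentum is \<open>Q\<close>
      itself, since \<open>\<phi>\<close> inverts \<open>\<psi>\<close>.\<close>
    proof (rule exI[of _ "\<lambda>t. \<psi> (Q t)"], rule exI[of _ "\<lambda>t. - g t (U t)"], intro conjI ballI)
      show "C1_with_deriv_on U (\<lambda>t. \<psi> (Q t)) {0..T}"
        unfolding C1_with_deriv_on_def
        using U_der continuous_on_compose2[OF psi_continuous[of UNIV] Q] by simp
      show "C1_with_deriv_on (\<lambda>t. \<phi> (\<psi> (Q t))) (\<lambda>t. - g t (U t)) {0..T}"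
        unfolding C1_with_deriv_on_def using Q_der gU by (simp add: continuous_on_minus)
      show "(U 0, U T) \<in> subdiff_domain j"
        using bc by (auto simp: subdiff_domain_def)
    qed (use bc norm_psi in auto)
    then show ?thesis by blast
  qed
qed

end

theorem corollary4p9:
  fixes T a :: real
    and \<phi> :: "real ^ 'n \<Rightarrow> real ^ 'n"
    and \<Phi> :: "real ^ 'n \<Rightarrow> real"
    and F :: "real \<Rightarrow> real ^ 'n \<Rightarrow> real"
    and gradF :: "real \<Rightarrow> real ^ 'n \<Rightarrow> real ^ 'n"
    and j :: "(real ^ 'n) \<times> (real ^ 'n) \<Rightarrow> ereal"
  assumes T_pos: "0 < T" and a_pos: "0 < a"
    and phi_homeo: "\<exists>\<psi>. homeomorphism (ball 0 a) UNIV \<phi> \<psi>"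
    and phi_zero: "\<phi> 0 = 0"
    and Phi_grad: "\<forall>x\<in>ball 0 a. GDERIV \<Phi> x :> \<phi> x"
    and Phi_C1: "continuous_on (ball 0 a) \<phi>"
    and Phi_nonpos: "\<forall>x\<in>cball 0 a. \<Phi> x \<le> 0"
    and Phi_cont: "continuous_on (cball 0 a) \<Phi>"
    and Phi_strict: "strictly_convex_on (cball 0 a) \<Phi>"
    and F_cont: "continuous_on ({0..T} \<times> UNIV) (\<lambda>(t, x). F t x)"
    and F_grad: "\<forall>t\<in>{0..T}. \<forall>x. GDERIV (F t) x :> gradF t x"
    and gradF_cont: "continuous_on ({0..T} \<times> UNIV) (\<lambda>(t, x). gradF t x)"
    and F_zero: "\<forall>t\<in>{0..T}. F t 0 = 0"
    and j_proper: "proper_fun j" and j_convex: "convex_fun j" and j_lsc: "lsc_fun j"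
    and j_zero: "j 0 = 0" and j_subdiff_zero: "0 \<in> subdifferential j 0"
    and gradF_bounded: "bounded ((\<lambda>(t, x). gradF t x) ` ({0..T} \<times> UNIV))"
    and F_anticoercive:
      "filterlim (\<lambda>x. integral {0..T} (\<lambda>t. F t x)) at_bot at_infinity"
  shows "\<exists>u. is_solution T a \<phi> gradF j u"
proof -
  obtain \<psi> where homeo: "homeomorphism (ball 0 a) UNIV \<phi> \<psi>"
    using phi_homeo by blast
  \<comment> \<open>Nonpositivity bounds \<open>\<Phi>\<close> from above; the lower bound comes
    from continuity on the compact closed ball.\<close>
  obtain M where M: "\<And>x. x \<in> cball 0 a \<Longrightarrow> norm (\<Phi> x) \<le> M"
    using compact_imp_bounded[OF compact_continuous_image[OF Phi_cont compact_cball]]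
    unfolding bounded_iff by blast
  have lower: "- M \<le> \<Phi> x" if "x \<in> cball 0 a" for x
    using M[OF that] by simp
  obtain C where C: "\<And>t x. t \<in> {0..T} \<Longrightarrow> norm (gradF t x) \<le> C"
    using gradF_bounded unfolding bounded_iff by fastforce
  interpret bvp T a C M \<phi> \<psi> \<Phi> F gradF j
    by unfold_locales (use assms homeo lower C in blast)+
  show ?thesis by (rule solution_exists)
qed

end
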